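(* Let $s:\mathbb{R}_+\to\mathbb{R}$ be a non-decreasing function of class $C^2(\mathbb{R}_+)$, let $\Omega_s$ be the rotating half-plane with rotation function $s$, put $h(x)=s(e^x)$, and let $f$ be an entire function of finite exponential type which is bounded on $\Omega_s$. Assume that $$\int_0^\infty h'(x)^2\,dx=\infty\qquad\text{and}\qquad \int_0^\infty|h''(x)|\,dx<\infty.$$ Then $f$ is constant.
   Context: For a non-decreasing continuous function $s:\mathbb{R}_+\to\mathbb{R}$, the rotating half-plane with rotation function $s$ is $$\Omega_s=\{re^{i\alpha}\mid r>0,\ s(r)<\alpha<s(r)+\pi\}.$$ An entire function $F$ is of finite exponential type if there are constants $A,B>0$ with $|F(z)|\le A e^{B|z|}$ for all $z\in\mathbb{C}$. *)

theory Defs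
  imports "HOL-Complex_Analysis.Complex_Analysis"
begin

text \<open>Throughout, the half-line of positive radii is the open interval \<open>{0<..}\<close>: the rotation
  function is only ever evaluated at radii \<open>r > 0\<close>.\<close>

definition rotating_half_plane :: "(real \<Rightarrow> real) \<Rightarrow> complex set" where
  "rotating_half_plane s =
     {complex_of_real r * cis \<alpha> | r \<alpha>. r > 0 \<and> s r < \<alpha> \<and> \<alpha> < s r + pi}"

definition finite_exponential_type :: "(complex \<Rightarrow> complex) \<Rightarrow> bool" where
  "finite_exponential_type F \<longleftrightarrow>
     (\<exists>A>0. \<exists>B>0. \<forall>z. norm (F z) \<le> A * exp (B * norm z))"

text \<open>Intended for open \<open>S\<close>, since \<open>C1_differentiable_on\<close> and \<open>deriv\<close> both refer to the
  two-sided derivative at every point of \<open>S\<close>.\<close>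

definition C2_differentiable_on :: "(real \<Rightarrow> real) \<Rightarrow> real set \<Rightarrow> bool"
    (infix "C2'_differentiable'_on" 50) where
  "g C2_differentiable_on S \<longleftrightarrow>
     g C1_differentiable_on S \<and> deriv g C1_differentiable_on S"

end

theory Submission
  imports Defs
begin

text \<open>In the coordinate \<open>w = x + iy\<close>, \<open>z = exp w\<close>, the complement of the rotating half-plane is the strip
  \<open>\<bar>y - c x\<bar> \<le> pi / 2\<close> with \<open>c = h + 3 * pi / 2\<close>, on whose edges \<open>F w = f (exp w)\<close> is bounded, while
  \<open>ln \<bar>F w\<bar>\<close> grows at most like \<open>exp x\<close>. With \<open>p = h'\<close> and \<open>t = y - c x\<close>, the function
  \<open>exp (x + \<integral>p\<^sup>2 + p * t) * cos t\<close> is nearly harmonic, because \<open>(x + \<integral>p\<^sup>2 + p * t, t)\<close> satisfies the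
  Cauchy-Riemann equations up to errors controlled by \<open>p'\<close>. Since \<open>\<bar>p'\<bar>\<close> is integrable, a correction
  turns it into a positive superharmonic function of the same size, and this exceeds \<open>exp x\<close> by the
  factor \<open>exp (\<integral>p\<^sup>2)\<close>, which is unbounded. Phragmen-Lindelof then bounds \<open>F\<close> on the strip, hence \<open>f\<close>
  everywhere, and Liouville's theorem applies.\<close>

section \<open>Maximum principle for the modulus of an entire function\<close>

text \<open>\<open>f'\<close> is known to be differentiable only at \<open>a\<close>, so no Taylor
  expansion is used: a positive \<open>f''\<close> makes \<open>f'\<close> positive just to the
  right of its zero \<open>a\<close>, and the mean value theorem lifts \<open>f\<close> above its
  maximum there.\<close>

lemma second_derivative_nonpos_at_max:
  fixes f f' :: "real \<Rightarrow> real"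
  assumes f: "\<And>x. \<bar>x - a\<bar> < e \<Longrightarrow> (f has_real_derivative f' x) (at x)" and e: "0 < e"
    and f': "(f' has_real_derivative f'') (at a)"
    and max: "\<And>x. \<bar>x - a\<bar> < e \<Longrightarrow> f x \<le> f a"
  shows "f'' \<le> 0"
proof (rule ccontr)
  assume "\<not> f'' \<le> 0"
  have "f' a = 0"
    using f[of a] e max by (intro DERIV_local_max[of f "f' a" a e]) (auto simp: abs_minus_commute)
  moreover obtain \<delta> where \<delta>: "0 < \<delta>" "\<And>h. 0 < h \<Longrightarrow> h < \<delta> \<Longrightarrow> f' a < f' (a + h)"
    using DERIV_pos_inc_right[OF f'] \<open>\<not> f'' \<le> 0\<close> by auto
  define u where "u = min \<delta> e / 2"
  have u: "0 < u" "u < \<delta>" "u < e" using \<delta> e by (auto simp: u_def)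
  have "\<exists>z. a < z \<and> z < a + u \<and> f (a + u) - f a = (a + u - a) * f' z"
    using u by (intro MVT2 f) auto
  then obtain z where z: "a < z" "z < a + u" "f (a + u) - f a = u * f' z" by auto
  have "0 < f' z" using \<delta>(2)[of "z - a"] z u \<open>f' a = 0\<close> by auto
  then have "f a < f (a + u)" using z u by (simp add: algebra_simps)
  with max[of "a + u"] u show False by auto
qed

text \<open>At a maximum of the ratio of \<open>norm F\<close> to \<open>exp V\<close> one may replace \<open>ln (norm F)\<close> by the real part
  of a holomorphic logarithm, which is harmonic.\<close>

lemma norm_le_exp_superharmonic:
  fixes F :: "complex \<Rightarrow> complex" and V :: "complex \<Rightarrow> real"
  assumes F: "F holomorphic_on UNIV" and S: "compact S" and V: "continuous_on S V"
    and Vx: "\<And>x y. ((\<lambda>x. V (Complex x y)) has_real_derivative Vx (Complex x y)) (at x)"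
    and Vxx: "\<And>x y. ((\<lambda>x. Vx (Complex x y)) has_real_derivative Vxx (Complex x y)) (at x)"
    and Vy: "\<And>x y. ((\<lambda>y. V (Complex x y)) has_real_derivative Vy (Complex x y)) (at y)"
    and Vyy: "\<And>x y. ((\<lambda>y. Vy (Complex x y)) has_real_derivative Vyy (Complex x y)) (at y)"
    and neg: "\<And>w. w \<in> interior S \<Longrightarrow> Vxx w + Vyy w < 0"
    and bd: "\<And>w. w \<in> S \<Longrightarrow> w \<notin> interior S \<Longrightarrow> norm (F w) \<le> M * exp (V w)"
    and M: "0 < M" and w: "w \<in> S"
  shows "norm (F w) \<le> M * exp (V w)"
proof -
  define u where "u = (\<lambda>w. norm (F w) * exp (- V w))"
  have "continuous_on S u" unfolding u_def
    using holomorphic_on_imp_continuous_on[OF F] V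
    by (intro continuous_intros) (auto intro: continuous_on_subset)
  then obtain w0 where w0: "w0 \<in> S" "\<And>z. z \<in> S \<Longrightarrow> u z \<le> u w0"
    using continuous_attains_sup[OF S, of u] w by blast
  have "u w0 \<le> M"
  proof (rule ccontr)
    assume *: "\<not> u w0 \<le> M"
    then have "w0 \<in> interior S"
      using bd[OF w0(1)] by (force simp: u_def exp_minus field_simps)
    have "F w0 \<noteq> 0" using * M by (auto simp: u_def)
    have "open (F -` (- {0}))"
      using holomorphic_on_imp_continuous_on[OF F] by (intro open_vimage) auto
    then have "open (interior S \<inter> F -` (- {0}))" by auto
    then obtain e where e: "0 < e" "ball w0 e \<subseteq> interior S \<inter> F -` (- {0})"
      using \<open>w0 \<in> interior S\<close> \<open>F w0 \<noteq> 0\<close> openE by blast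
    obtain g where g: "g holomorphic_on ball w0 e" "\<And>z. z \<in> ball w0 e \<Longrightarrow> F z = exp (g z)"
      using contractible_imp_holomorphic_log[of F "ball w0 e"] F e convex_imp_contractible[of "ball w0 e"]
      by (metis Compl_iff IntD2 convex_ball holomorphic_on_subset singletonI subset_UNIV subset_eq vimage_eq)
    have g': "deriv g holomorphic_on ball w0 e" using g by (simp add: holomorphic_deriv)
    have le: "Re (g z) - V z \<le> Re (g w0) - V w0" if "z \<in> ball w0 e" for z
    proof -
      have "z \<in> S" using that e interior_subset by blast
      moreover have "u y = exp (Re (g y) - V y)" if "y \<in> ball w0 e" for y
        using g(2)[OF that] by (simp add: u_def exp_diff exp_minus field_simps)
      ultimately show ?thesis using w0(2)[of z] that e by simp
    qed
    \<comment> \<open>Derivative along a line of direction \<open>d\<close>. It is applied with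
      \<open>d = 1\<close> and \<open>d = \<i>\<close>, to \<open>g\<close>, to
      \<open>deriv g\<close>, and to \<open>deriv g\<close> times \<open>\<i>\<close>.\<close>
    have chain: "((\<lambda>t. Re (G (c + of_real t * d))) has_real_derivative Re (deriv G (c + of_real t * d) * d)) (at t)"
      if "c + of_real t * d \<in> ball w0 e" "G holomorphic_on ball w0 e" for G c d t
    proof -
      have "(G has_field_derivative deriv G (c + of_real t * d)) (at (c + of_real t * d))"
        using that by (simp add: holomorphic_derivI)
      moreover have "((\<lambda>t. c + of_real t * d) has_vector_derivative d) (at t)"
        by (auto intro!: derivative_eq_intros)
      ultimately have "((G \<circ> (\<lambda>t. c + of_real t * d)) has_vector_derivative d * deriv G (c + of_real t * d)) (at t)"
        by (rule field_vector_diff_chain_at[rotated])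
      from bounded_linear.has_vector_derivative[OF bounded_linear_Re this] show ?thesis
        by (simp add: o_def has_real_derivative_iff_has_vector_derivative mult.commute)
    qed
    define x0 y0 where "x0 = Re w0" and "y0 = Im w0"
    have w0': "w0 = Complex x0 y0" by (simp add: x0_def y0_def)
    have cx: "Complex x y0 = Complex 0 y0 + of_real x * 1" for x by (simp add: complex_eq_iff)
    have cy: "Complex x0 y = Complex x0 0 + of_real y * \<i>" for y by (simp add: complex_eq_iff)
    have bx: "Complex x y0 \<in> ball w0 e" if "\<bar>x - x0\<bar> < e" for x
      using that by (simp add: w0' dist_norm cmod_def)
    have byy: "Complex x0 y \<in> ball w0 e" if "\<bar>y - y0\<bar> < e" for y
      using that by (simp add: w0' dist_norm cmod_def)
    \<comment> \<open>The real part of \<open>g\<close> has second derivative \<open>Re g''\<close>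
      in the horizontal direction and \<open>- Re g''\<close> in the vertical one. Adding the two
      inequalities at the maximum leaves \<open>0 \<le> Vxx w0 + Vyy w0\<close>, against
      \<open>neg\<close>.\<close>
    have "Re (deriv (deriv g) w0) - Vxx w0 \<le> 0"
    proof (rule second_derivative_nonpos_at_max[of x0 e "\<lambda>x. Re (g (Complex x y0)) - V (Complex x y0)"
          "\<lambda>x. Re (deriv g (Complex x y0)) - Vx (Complex x y0)"])
      show "((\<lambda>x. Re (g (Complex x y0)) - V (Complex x y0)) has_real_derivative
          Re (deriv g (Complex x y0)) - Vx (Complex x y0)) (at x)" if "\<bar>x - x0\<bar> < e" for x
        using chain[of "Complex 0 y0" x 1 g] bx[OF that] g(1) Vx unfolding cx[symmetric]
        by (intro DERIV_diff) auto
      show "((\<lambda>x. Re (deriv g (Complex x y0)) - Vx (Complex x y0)) has_real_derivative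
          Re (deriv (deriv g) w0) - Vxx w0) (at x0)"
        using chain[of "Complex 0 y0" x0 1 "deriv g"] bx[of x0] e g' Vxx unfolding cx[symmetric] w0'
        by (intro DERIV_diff) auto
    qed (use e le[OF bx] in \<open>auto simp: w0'\<close>)
    moreover have "- Re (deriv (deriv g) w0) - Vyy w0 \<le> 0"
    proof (rule second_derivative_nonpos_at_max[of y0 e "\<lambda>y. Re (g (Complex x0 y)) - V (Complex x0 y)"
          "\<lambda>y. Re (deriv g (Complex x0 y) * \<i>) - Vy (Complex x0 y)"])
      show "((\<lambda>y. Re (g (Complex x0 y)) - V (Complex x0 y)) has_real_derivative
          Re (deriv g (Complex x0 y) * \<i>) - Vy (Complex x0 y)) (at y)" if "\<bar>y - y0\<bar> < e" for y
        using chain[of "Complex x0 0" y \<i> g] byy[OF that] g(1) Vy unfolding cy[symmetric]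
        by (intro DERIV_diff) auto
      have "((\<lambda>y. Re (deriv g (Complex x0 y) * \<i>)) has_real_derivative
          Re (deriv (\<lambda>z. deriv g z * \<i>) (Complex x0 y0) * \<i>)) (at y0)"
        using chain[of "Complex x0 0" y0 \<i> "\<lambda>z. deriv g z * \<i>"] byy[of y0] e
          holomorphic_on_mult[OF g' holomorphic_on_const] unfolding cy[symmetric] by auto
      moreover have "deriv (\<lambda>z. deriv g z * \<i>) (Complex x0 y0) = deriv (deriv g) w0 * \<i>"
        using holomorphic_derivI[OF g' open_ball] e
        by (intro DERIV_imp_deriv) (auto simp: w0'[symmetric] intro!: derivative_eq_intros)
      ultimately show "((\<lambda>y. Re (deriv g (Complex x0 y) * \<i>) - Vy (Complex x0 y)) has_real_derivative
          - Re (deriv (deriv g) w0) - Vyy w0) (at y0)"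
        using Vyy unfolding w0' by (intro DERIV_diff) auto
    qed (use e le[OF byy] in \<open>auto simp: w0'\<close>)
    ultimately show False using neg[OF \<open>w0 \<in> interior S\<close>] by linarith
  qed
  then have "u w \<le> M" using w0(2)[OF w] by linarith
  then show ?thesis by (simp add: u_def exp_minus field_simps)
qed

section \<open>Antiderivatives and exponential smoothing of the slope\<close>

lemma antiderivative_exists:
  fixes f :: "real \<Rightarrow> real"
  assumes "continuous_on UNIV f"
  obtains F where "\<And>x. (F has_real_derivative f x) (at x)" "F a = 0"
proof -
  obtain F where "\<And>x. (F has_vector_derivative f x) (at x)"
    using einterval_antiderivative[of "-\<infinity>" \<infinity> f] assms
    by (auto simp: continuous_on_eq_continuous_at)
  then have "((\<lambda>x. F x - F a) has_real_derivative f x) (at x)" for x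
    by (auto simp: has_real_derivative_iff_has_vector_derivative[symmetric] intro!: derivative_eq_intros)
  then show thesis by (intro that[of "\<lambda>x. F x - F a"]) auto
qed

text \<open>Both \<open>V - p\<close> and \<open>V + p\<close> are nondecreasing on the interval.
  With \<open>V\<close> an antiderivative of \<open>\<bar>p'\<bar>\<close> this is the bound by the
  total variation, obtained without integrals.\<close>

lemma abs_diff_le_variation:
  fixes p V :: "real \<Rightarrow> real"
  assumes p: "\<And>x. (p has_real_derivative p' x) (at x)"
    and V: "\<And>x. (V has_real_derivative v x) (at x)" and le: "\<And>x. a \<le> x \<Longrightarrow> \<bar>p' x\<bar> \<le> v x" and ab: "a \<le> b"
  shows "\<bar>p b - p a\<bar> \<le> V b - V a"
proof -
  have "V a - p a \<le> V b - p b"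
    using p V le ab by (intro DERIV_nonneg_imp_nondecreasing[of a b "\<lambda>x. V x - p x"])
      (auto intro!: exI DERIV_diff simp: abs_le_iff)
  moreover have "V a + p a \<le> V b + p b"
  proof (rule DERIV_nonneg_imp_nondecreasing[OF ab])
    fix x assume "a \<le> x" "x \<le> b"
    then show "\<exists>y. ((\<lambda>x. V x + p x) has_real_derivative y) (at x) \<and> 0 \<le> y"
      using le[of x] by (intro exI[of _ "v x + p' x"] conjI DERIV_add p V) auto
  qed
  ultimately show ?thesis by (simp add: abs_le_iff)
qed

text \<open>\<open>p\<close> is only \<open>C\<^sup>1\<close>, so the barrier uses the smoothed slope \<open>p - r\<close>. The weight \<open>k\<close> is the convolution
  of \<open>M * \<bar>d\<bar>\<close> with the kernel \<open>exp (- w * \<bar>x\<bar>)\<close>, truncated to \<open>{a..X}\<close>, plus \<open>e * exp (w * (x - X))\<close>: it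
  satisfies \<open>k'' = w\<^sup>2 * k - 2 * w * M * \<bar>d\<bar>\<close>, so that its second derivative absorbs errors of size \<open>\<bar>d\<bar>\<close>
  even where \<open>\<bar>d\<bar>\<close> is not small, and it is at least \<open>e\<close> at \<open>X\<close>.\<close>

lemma exponential_smoothing:
  fixes d I :: "real \<Rightarrow> real"
  assumes d: "continuous_on UNIV d" and I: "\<And>x. (I has_real_derivative \<bar>d x\<bar>) (at x)"
    and w: "0 < w" and M: "0 \<le> M" and e: "0 < e" and aX: "a \<le> X"
  obtains r k l where
    "\<And>x. (r has_real_derivative d x - w * r x) (at x)"
    "\<And>x. (k has_real_derivative w * l x) (at x)"
    "\<And>x. (l has_real_derivative w * k x - 2 * M * \<bar>d x\<bar>) (at x)"
    "e \<le> k X"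
    "\<And>x. a \<le> x \<Longrightarrow> x \<le> X \<Longrightarrow> 0 < k x \<and> \<bar>l x\<bar> \<le> k x \<and> M * \<bar>r x\<bar> \<le> k x
      \<and> \<bar>r x\<bar> \<le> I x - I a \<and> k x \<le> e + M * (I X - I a)"
proof -
  obtain R where R: "\<And>x. (R has_real_derivative exp (w * x) * d x) (at x)" "R a = 0"
    using d by (rule_tac antiderivative_exists[of "\<lambda>x. exp (w * x) * d x" a]) (auto intro!: continuous_intros)
  obtain J where J: "\<And>x. (J has_real_derivative exp (w * x) * \<bar>d x\<bar>) (at x)" "J a = 0"
    using d by (rule_tac antiderivative_exists[of "\<lambda>x. exp (w * x) * \<bar>d x\<bar>" a]) (auto intro!: continuous_intros)
  obtain N where N: "\<And>x. (N has_real_derivative exp (- (w * x)) * \<bar>d x\<bar>) (at x)" "N X = 0"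
    using d by (rule_tac antiderivative_exists[of "\<lambda>x. exp (- (w * x)) * \<bar>d x\<bar>" X]) (auto intro!: continuous_intros)
  \<comment> \<open>Variation of constants: \<open>r\<close> and \<open>j\<close> solve
    \<open>y' = d - w * y\<close> and \<open>y' = \<bar>d\<bar> - w * y\<close> forwards from the
    value 0 at \<open>a\<close>, and \<open>k2\<close> solves
    \<open>y' = w * y - M * \<bar>d\<bar>\<close> backwards from the value \<open>e\<close> at
    \<open>X\<close>. The one-sided pieces \<open>M * j\<close> and \<open>k2\<close> add up to the
    two-sided weight \<open>k\<close>, and their difference gives \<open>l\<close>.\<close>
  define r where "r = (\<lambda>x. exp (- (w * x)) * R x)"
  define j where "j = (\<lambda>x. exp (- (w * x)) * J x)"
  define k2 where "k2 = (\<lambda>x. exp (w * x) * (e * exp (- (w * X)) - M * N x))"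
  have Er: "exp (- (w * x)) * (exp (w * x) * y) = y" "exp (w * x) * (exp (- (w * x)) * y) = y" 
      "exp (w * x) * exp (- (w * x)) = 1" for x y
    by (simp_all flip: mult.assoc exp_add)
  have r': "(r has_real_derivative d x - w * r x) (at x)" for x
    unfolding r_def by (rule DERIV_cong, (rule derivative_eq_intros R refl)+) (simp add: algebra_simps Er)
  have j': "(j has_real_derivative \<bar>d x\<bar> - w * j x) (at x)" for x
    unfolding j_def by (rule DERIV_cong, (rule derivative_eq_intros J refl)+) (simp add: algebra_simps Er)
  have k2': "(k2 has_real_derivative w * k2 x - M * \<bar>d x\<bar>) (at x)" for x
    unfolding k2_def by (rule DERIV_cong, (rule derivative_eq_intros N refl)+) (simp add: algebra_simps Er)
  have Rj: "\<bar>r x\<bar> \<le> j x" if "a \<le> x" for x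
  proof -
    have "\<bar>R x - R a\<bar> \<le> J x - J a"
      using that by (intro abs_diff_le_variation[OF R(1) J(1)]) (auto simp: abs_mult)
    then show ?thesis using R J by (simp add: r_def j_def abs_mult)
  qed
  have jI: "j x \<le> I x - I a" if "a \<le> x" for x
  proof -
    have "I a - j a \<le> I x - j x"
    proof (rule DERIV_nonneg_imp_nondecreasing[OF that])
      fix z assume "a \<le> z"
      then have "0 \<le> j z" using Rj[of z] by linarith
      then show "\<exists>y. ((\<lambda>x. I x - j x) has_real_derivative y) (at z) \<and> 0 \<le> y"
        using w by (intro exI[of _ "\<bar>d z\<bar> - (\<bar>d z\<bar> - w * j z)"] conjI DERIV_diff I j') auto
    qed
    then show ?thesis using J by (simp add: j_def)
  qed
  have Npos: "N x \<le> 0" if "x \<le> X" for x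
    using DERIV_nonneg_imp_nondecreasing[OF that, of N] N by force
  have k2pos: "0 < k2 x" if "x \<le> X" for x
  proof -
    have "M * N x \<le> 0" using Npos[OF that] M by (simp add: mult_nonneg_nonpos)
    moreover have "0 < e * exp (- (w * X))" using e by simp
    ultimately have "0 < e * exp (- (w * X)) - M * N x" by linarith
    then show ?thesis by (simp add: k2_def)
  qed
  have k2X: "k2 X = e" using N by (simp add: k2_def mult.left_commute flip: exp_add)
  have k2I: "k2 x \<le> e + M * (I X - I x)" if "x \<le> X" for x
  proof -
    have "k2 x + M * I x \<le> k2 X + M * I X"
    proof (rule DERIV_nonneg_imp_nondecreasing[OF that])
      fix z assume "z \<le> X"
      then show "\<exists>y. ((\<lambda>x. k2 x + M * I x) has_real_derivative y) (at z) \<and> 0 \<le> y"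
        using w k2pos[of z]
        by (intro exI[of _ "(w * k2 z - M * \<bar>d z\<bar>) + M * \<bar>d z\<bar>"] conjI DERIV_add DERIV_cmult I k2') auto
    qed
    then show ?thesis by (simp add: k2X algebra_simps)
  qed
  show thesis
  proof (rule that[of r "\<lambda>x. M * j x + k2 x" "\<lambda>x. k2 x - M * j x"])
    show "((\<lambda>x. M * j x + k2 x) has_real_derivative w * (k2 x - M * j x)) (at x)" for x
      by (rule DERIV_cong[OF DERIV_add[OF DERIV_cmult[OF j'] k2']]) (simp add: algebra_simps)
    show "((\<lambda>x. k2 x - M * j x) has_real_derivative w * (M * j x + k2 x) - 2 * M * \<bar>d x\<bar>) (at x)" for x
      by (rule DERIV_cong[OF DERIV_diff[OF k2' DERIV_cmult[OF j']]]) (simp add: algebra_simps)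
    show "e \<le> M * j X + k2 X"
      using k2X Rj[OF aX] M by simp
    fix x assume x: "a \<le> x" "x \<le> X"
    have 1: "0 \<le> M * j x" "M * \<bar>r x\<bar> \<le> M * j x" "M * j x \<le> M * (I x - I a)"
      using Rj[OF x(1)] jI[OF x(1)] M by (auto intro!: mult_left_mono mult_nonneg_nonneg)
    have "\<bar>r x\<bar> \<le> I x - I a" using Rj[OF x(1)] jI[OF x(1)] by linarith
    then show "0 < M * j x + k2 x \<and> \<bar>k2 x - M * j x\<bar> \<le> M * j x + k2 x \<and> M * \<bar>r x\<bar> \<le> M * j x + k2 x
        \<and> \<bar>r x\<bar> \<le> I x - I a \<and> M * j x + k2 x \<le> e + M * (I X - I a)"
      using 1 k2pos[OF x(2)] k2I[OF x(2)] by (auto simp: abs_le_iff algebra_simps)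
  qed (use r' in auto)
qed

section \<open>Laplacian of the barrier\<close>

text \<open>The left-hand side is \<open>\<Delta>V / E\<close> for the function \<open>V = E * (cos t + k * b)\<close> of the next lemma, with
  \<open>b'' = 2 * cos t + 2 * L * sin t - 1 - b\<close> substituted. The choice \<open>S = 1 + L\<^sup>2\<close> makes all terms linear in
  \<open>k\<close> that do not tend to zero add up to \<open>- S * k\<close>.\<close>

lemma laplacian_factor_le:
  fixes p q r L k l d t w M S cs sn b0 b1 tau Q :: real
  defines "\<delta> \<equiv> r * (p + w * t) - S * k"
  defines "a' \<equiv> 2 * p * d - S * w * l + w * (d - w * r) * t - 2 * w * r * p - q * d"
  assumes q: "q = p - r" and S: "S = 1 + L\<^sup>2"
    and k: "0 \<le> k" "k \<le> tau" and l: "\<bar>l\<bar> \<le> k" and r: "\<bar>r\<bar> \<le> tau" and pL: "\<bar>p - L\<bar> \<le> tau"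
    and tau: "tau \<le> 1" and w: "0 \<le> w" "w \<le> 1"
    and Q: "1 \<le> Q" "\<bar>p\<bar> \<le> Q" "\<bar>q\<bar> \<le> Q" "\<bar>L\<bar> \<le> Q" "\<bar>t\<bar> \<le> Q" "\<bar>b0\<bar> \<le> Q" "\<bar>b1\<bar> \<le> Q"
    and trig: "\<bar>cs\<bar> \<le> 1" "\<bar>sn\<bar> \<le> 1" and b0: "1 / 2 \<le> b0" and M: "0 \<le> M"
  shows "((1 + \<delta>)\<^sup>2 + a' + q\<^sup>2) * (cs + k * b0)
      + 2 * (1 + \<delta>) * (p * sn + w * l * b0 - p * k * b1)
      + (d * sn - p\<^sup>2 * cs + w * (w * k - 2 * M * \<bar>d\<bar>) * b0 - 2 * p * (w * l) * b1 - d * k * b1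
          + p\<^sup>2 * k * (2 * cs + 2 * L * sn - 1 - b0))
      + 2 * q * (k * b1 - sn) + (k * (2 * cs + 2 * L * sn - 1 - b0) - cs)
    \<le> - k + 100 * Q ^ 5 * (w * k + tau * k + \<bar>r\<bar> + \<bar>d\<bar>) - w * M * \<bar>d\<bar>" (is "?T \<le> _")
proof -
  have tau0: "0 \<le> tau" using k by simp
  have ab: "x * y \<le> X * Y" if "\<bar>x\<bar> \<le> X" "\<bar>y\<bar> \<le> Y" for x y X Y :: real
  proof -
    have "x * y \<le> \<bar>x\<bar> * \<bar>y\<bar>" by (metis abs_ge_self abs_mult)
    also have "\<dots> \<le> X * Y" using that by (intro mult_mono) auto
    finally show ?thesis .
  qed
  have ab': "\<bar>x * y\<bar> \<le> X * Y" if "\<bar>x\<bar> \<le> X" "\<bar>y\<bar> \<le> Y" for x y X Y :: real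
    using that by (auto simp: abs_mult intro!: mult_mono)
  have Qp: "Q \<le> Q^2" "Q^2 \<le> Q^3" "Q^3 \<le> Q^4" "Q^4 \<le> Q^5" "1 \<le> Q^5"
    using Q(1) by (auto intro!: power_increasing simp: self_le_power)
  have ak: "\<bar>k\<bar> \<le> k" using k by simp
  have two: "\<bar>2 * x\<bar> \<le> 2 * y" if "\<bar>x\<bar> \<le> y" for x y :: real using that by (simp add: abs_mult)
  have S2: "\<bar>S\<bar> \<le> 2 * Q^2" and S1: "1 \<le> S"
  proof -
    have "L\<^sup>2 \<le> Q\<^sup>2" using Q(4) by (metis abs_ge_zero power2_abs power_mono)
    then show "\<bar>S\<bar> \<le> 2 * Q^2" using Q(1) Qp(1) by (simp add: S)
    show "1 \<le> S" by (simp add: S)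
  qed
  have wt: "\<bar>w * t\<bar> \<le> Q" using ab'[of w 1 t Q] w Q by simp
  have pwt: "\<bar>p + w * t\<bar> \<le> 2 * Q" using wt Q(2) by linarith
  have \<delta>1: "\<bar>\<delta>\<bar> \<le> 2 * Q^2 * (k + \<bar>r\<bar>)"
  proof -
    have "\<bar>r * (p + w * t)\<bar> \<le> \<bar>r\<bar> * (2 * Q)" by (rule ab'[OF order_refl pwt])
    moreover have "\<bar>r\<bar> * (2 * Q) \<le> \<bar>r\<bar> * (2 * Q^2)" using Qp by (intro mult_left_mono) auto
    moreover have "\<bar>S * k\<bar> \<le> 2 * Q^2 * k" by (rule ab'[OF S2 ak])
    ultimately have "\<bar>\<delta>\<bar> \<le> \<bar>r\<bar> * (2 * Q^2) + 2 * Q^2 * k" unfolding \<delta>_def by linarith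
    then show ?thesis by (simp add: algebra_simps)
  qed
  have \<delta>2: "\<bar>\<delta>\<bar> \<le> 4 * Q^2 * tau"
  proof -
    have "2 * Q^2 * (k + \<bar>r\<bar>) \<le> 2 * Q^2 * (tau + tau)" by (intro mult_left_mono add_mono k r) simp
    then show ?thesis using \<delta>1 by (simp add: algebra_simps)
  qed
  have \<delta>3: "\<bar>\<delta>\<bar> \<le> 4 * Q^2" using \<delta>2 tau mult_left_mono[of tau 1 "4*Q^2"] by simp
  \<comment> \<open>One factor is bounded by \<open>tau\<close>, the other linearly in
    \<open>k\<close> and \<open>\<bar>r\<bar>\<close>. Thus \<open>k\<close> enters only with the
    small factor \<open>tau\<close>.\<close>
  have \<delta>\<delta>: "\<bar>\<delta>\<^sup>2\<bar> \<le> 8 * Q^4 * (tau * k + \<bar>r\<bar>)"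
  proof -
    have "\<bar>\<delta>\<^sup>2\<bar> \<le> (4 * Q^2 * tau) * (2 * Q^2 * (k + \<bar>r\<bar>))"
      unfolding power2_eq_square[of \<delta>] using \<delta>1 \<delta>2 by (intro ab')
    also have "\<dots> = 8 * Q^4 * (tau * k + tau * \<bar>r\<bar>)" by (simp add: power_numeral_reduce algebra_simps)
    also have "\<dots> \<le> 8 * Q^4 * (tau * k + 1 * \<bar>r\<bar>)"
      using tau Q by (intro mult_left_mono add_left_mono mult_right_mono) auto
    finally show ?thesis by simp
  qed
  have \<delta>\<delta>2: "\<bar>\<delta>\<^sup>2\<bar> \<le> 16 * Q^4 * tau"
  proof -
    have "\<bar>\<delta>\<^sup>2\<bar> \<le> (4 * Q^2 * tau) * (4 * Q^2)"
      unfolding power2_eq_square[of \<delta>] using \<delta>3 \<delta>2 by (intro ab')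
    then show ?thesis by (simp add: power_numeral_reduce algebra_simps)
  qed
  have qp: "\<bar>q\<^sup>2 - p\<^sup>2\<bar> \<le> 2 * Q * \<bar>r\<bar>"
  proof -
    have "\<bar>(q + p) * (q - p)\<bar> \<le> (2 * Q) * \<bar>r\<bar>" by (rule ab') (use Q(2,3) in linarith, use q in simp)
    then show ?thesis by (simp add: power2_eq_square algebra_simps)
  qed
  have a': "\<bar>a'\<bar> \<le> 4 * Q * \<bar>d\<bar> + 2 * Q^2 * (w * k) + 3 * Q * \<bar>r\<bar>"
  proof -
    have 1: "\<bar>p * d\<bar> \<le> Q * \<bar>d\<bar>" "\<bar>q * d\<bar> \<le> Q * \<bar>d\<bar>" by (intro ab' Q order_refl)+
    have "\<bar>S * (w * l)\<bar> \<le> (2 * Q^2) * (w * k)" by (rule ab'[OF S2 ab'[OF _ l]]) (use w in simp)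
    then have 2: "\<bar>S * w * l\<bar> \<le> 2 * Q^2 * (w * k)" by (simp add: mult.assoc)
    have wr: "\<bar>w * r\<bar> \<le> \<bar>r\<bar>" using ab'[of w 1 r "\<bar>r\<bar>"] w by simp
    have "\<bar>w * t * (d - w * r)\<bar> \<le> Q * (\<bar>d\<bar> + \<bar>r\<bar>)" by (rule ab'[OF wt]) (use wr in linarith)
    then have 3: "\<bar>w * (d - w * r) * t\<bar> \<le> Q * \<bar>d\<bar> + Q * \<bar>r\<bar>" by (simp add: algebra_simps)
    have 4: "\<bar>w * r * p\<bar> \<le> \<bar>r\<bar> * Q" by (rule ab'[OF wr Q(2)])
    have "a' = 2 * (p * d) + - (S * w * l) + w * (d - w * r) * t + 2 * - (w * r * p) + - (q * d)"
      unfolding a'_def by algebra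
    also have "\<bar>\<dots>\<bar> \<le> 2 * (Q * \<bar>d\<bar>) + 2 * Q^2 * (w * k) + (Q * \<bar>d\<bar> + Q * \<bar>r\<bar>) + 2 * (\<bar>r\<bar> * Q) + Q * \<bar>d\<bar>"
      using 1 2 3 4 by (intro abs_triangle_ineq[THEN order_trans] add_mono two) simp_all
    finally show ?thesis by (simp add: algebra_simps)
  qed
  \<comment> \<open>Freezing \<open>p\<close> and \<open>q\<close> at \<open>L\<close> and dropping
    \<open>r\<close> and \<open>d\<close>, the terms linear in \<open>k\<close> without a factor
    \<open>w\<close> are \<open>- 2 * S * k * (cs + L * sn)\<close> from the exponent and
    \<open>S * k * (b'' + b)\<close> from the corrector; they add up to \<open>- S * k\<close>.
    \<open>X1\<close> to \<open>X3\<close> are the cost of freezing, \<open>X4\<close> and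
    \<open>X5\<close> the remaining multiples of \<open>cs\<close> and \<open>sn\<close>,
    \<open>X6\<close> and \<open>X7\<close> those of \<open>k * b0\<close> and
    \<open>k * b1\<close>, \<open>X8\<close> the terms with \<open>l\<close>, and \<open>X9\<close>
    the second derivative of \<open>k\<close>.\<close>
  define X1 where "X1 = -2 * (p - L) * S * k * sn"
  define X2 where "X2 = (p\<^sup>2 - L\<^sup>2) * k * (2 * cs + 2 * L * sn - 1)"
  define X3 where "X3 = (q\<^sup>2 - p\<^sup>2) * k * b0"
  define X4 where "X4 = cs * (2 * (r * (p + w * t)) + \<delta>\<^sup>2 + a' + (q\<^sup>2 - p\<^sup>2))"
  define X5 where "X5 = sn * (2 * r + 2 * (p * (r * (p + w * t))) + d)"
  define X6 where "X6 = k * (b0 * (2 * \<delta> + \<delta>\<^sup>2 + a'))"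
  define X7 where "X7 = - k * (b1 * (2 * r + 2 * (p * \<delta>) + d))"
  define X8 where "X8 = w * l * (2 * (1 + \<delta>) * b0 - 2 * p * b1)"
  define X9 where "X9 = (w\<^sup>2 * k - 2 * w * M * \<bar>d\<bar>) * b0"
  have id: "?T = - S * k + X1 + X2 + X3 + X4 + X5 + X6 + X7 + X8 + X9"
    unfolding X1_def X2_def X3_def X4_def X5_def X6_def X7_def X8_def X9_def a'_def \<delta>_def q S
    by algebra
  have tk: "0 \<le> tau * k" "0 \<le> w * k" using tau0 k w by auto
  let ?K = "Q^5"
  \<comment> \<open>As \<open>1 \<le> Q\<close>, all powers of \<open>Q\<close> can be raised to the
    fifth, the highest that occurs. Only the numerical coefficients have to be counted
    afterwards.\<close>
  have lift: "c * y * z \<le> c * ?K * z" if "y \<le> ?K" "0 \<le> c" "0 \<le> z" for c y z :: real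
    using that by (intro mult_right_mono mult_left_mono) auto
  have x1: "X1 \<le> 4 * ?K * (tau * k)"
  proof -
    have "X1 = (2 * (L - p)) * (S * (k * sn))" unfolding X1_def by algebra
    also have "\<dots> \<le> (2 * tau) * ((2 * Q^2) * (k * 1))"
      by (rule ab[OF _ ab'[OF S2 ab'[OF ak trig(2)]]]) (rule two, metis pL abs_minus_commute)
    also have "\<dots> = 4 * Q^2 * (tau * k)" by algebra
    also have "\<dots> \<le> 4 * ?K * (tau * k)" using Qp tk by (intro lift) auto
    finally show ?thesis .
  qed
  have Lsn: "\<bar>L * sn\<bar> \<le> Q" using ab'[of L Q sn 1] Q trig by simp
  have x2: "X2 \<le> 10 * ?K * (tau * k)"
  proof -
    have "X2 = ((p + L) * (p - L)) * (k * (2 * cs + 2 * (L * sn) - 1))" unfolding X2_def by algebra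
    also have "\<dots> \<le> ((2 * Q) * tau) * (k * (5 * Q))"
      by (rule ab[OF ab'[OF _ pL] ab'[OF ak]]) (use Q(2,4) in linarith, use trig(1) Lsn Q(1) in linarith)
    also have "\<dots> = 10 * Q^2 * (tau * k)" by algebra
    also have "\<dots> \<le> 10 * ?K * (tau * k)" using Qp tk by (intro lift) auto
    finally show ?thesis .
  qed
  have x3: "X3 \<le> 2 * ?K * (tau * k)"
  proof -
    have "2 * Q * \<bar>r\<bar> \<le> 2 * Q * tau" using r Q by (intro mult_left_mono) auto
    then have "\<bar>q\<^sup>2 - p\<^sup>2\<bar> \<le> 2 * Q * tau" using qp by linarith
    then have "X3 \<le> ((2 * Q * tau) * k) * Q" unfolding X3_def by (intro ab[OF ab'[OF _ ak] Q(6)])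
    also have "\<dots> = 2 * Q^2 * (tau * k)" by algebra
    also have "\<dots> \<le> 2 * ?K * (tau * k)" using Qp tk by (intro lift) auto
    finally show ?thesis .
  qed
  have rpwt: "\<bar>r * (p + w * t)\<bar> \<le> \<bar>r\<bar> * (2 * Q)" by (rule ab'[OF order_refl pwt])
  have x4: "X4 \<le> ?K * (17 * \<bar>r\<bar> + 8 * (tau * k) + 4 * \<bar>d\<bar> + 2 * (w * k))"
  proof -
    have "X4 \<le> 1 * (2 * (\<bar>r\<bar> * (2 * Q)) + 8 * Q^4 * (tau * k + \<bar>r\<bar>)
        + (4 * Q * \<bar>d\<bar> + 2 * Q^2 * (w * k) + 3 * Q * \<bar>r\<bar>) + 2 * Q * \<bar>r\<bar>)"
      unfolding X4_def
      by (intro ab[OF trig(1)] abs_triangle_ineq[THEN order_trans] add_mono rpwt \<delta>\<delta> a' qp two)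
    also have "\<dots> = 9 * Q * \<bar>r\<bar> + 8 * Q^4 * (tau * k) + 8 * Q^4 * \<bar>r\<bar> + 4 * Q * \<bar>d\<bar> + 2 * Q^2 * (w * k)"
      by (simp add: algebra_simps)
    also have "\<dots> \<le> 9 * ?K * \<bar>r\<bar> + 8 * ?K * (tau * k) + 8 * ?K * \<bar>r\<bar> + 4 * ?K * \<bar>d\<bar> + 2 * ?K * (w * k)"
      using Qp tk by (intro add_mono lift) auto
    finally show ?thesis by (simp add: algebra_simps)
  qed
  have x5: "X5 \<le> ?K * (6 * \<bar>r\<bar> + \<bar>d\<bar>)"
  proof -
    have "\<bar>p * (r * (p + w * t))\<bar> \<le> Q * (\<bar>r\<bar> * (2 * Q))" by (rule ab'[OF Q(2) rpwt])
    then have "X5 \<le> 1 * (2 * \<bar>r\<bar> + 2 * (Q * (\<bar>r\<bar> * (2 * Q))) + \<bar>d\<bar>)"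
      unfolding X5_def
      by (intro ab[OF trig(2)] abs_triangle_ineq[THEN order_trans] add_mono two order_refl)
    also have "\<dots> = 2 * 1 * \<bar>r\<bar> + 4 * Q^2 * \<bar>r\<bar> + 1 * 1 * \<bar>d\<bar>"
      by (simp add: algebra_simps power2_eq_square)
    also have "\<dots> \<le> 2 * ?K * \<bar>r\<bar> + 4 * ?K * \<bar>r\<bar> + 1 * ?K * \<bar>d\<bar>"
      using Qp by (intro add_mono lift) auto
    finally show ?thesis by (simp add: algebra_simps)
  qed
  have k1: "k \<le> 1" using k tau by linarith
  have x6: "X6 \<le> ?K * (27 * (tau * k) + 4 * \<bar>d\<bar> + 2 * (w * k))"
  proof -
    have wk: "2 * Q^2 * (w * k) \<le> 2 * Q^2 * w" using k1 w mult_left_mono[of k 1 w]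
      by (intro mult_left_mono) auto
    have "3 * Q * \<bar>r\<bar> \<le> 3 * Q * tau" using r Q by (intro mult_left_mono) auto
    then have "\<bar>a'\<bar> \<le> 4 * Q * \<bar>d\<bar> + 2 * Q^2 * w + 3 * Q * tau" using a' wk by linarith
    then have "X6 \<le> k * (Q * (2 * (4 * Q^2 * tau) + 16 * Q^4 * tau + (4 * Q * \<bar>d\<bar> + 2 * Q^2 * w + 3 * Q * tau)))"
      unfolding X6_def
      by (intro ab[OF ak] ab'[OF Q(6)] abs_triangle_ineq[THEN order_trans] add_mono \<delta>2 \<delta>\<delta>2 two)
    also have "\<dots> = 8 * Q^3 * (tau * k) + 16 * Q^5 * (tau * k) + 4 * Q^2 * (k * \<bar>d\<bar>)
        + 2 * Q^3 * (w * k) + 3 * Q^2 * (tau * k)" by algebra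
    also have "\<dots> \<le> 8 * ?K * (tau * k) + 16 * ?K * (tau * k) + 4 * ?K * (k * \<bar>d\<bar>)
        + 2 * ?K * (w * k) + 3 * ?K * (tau * k)"
      using Qp tk k by (intro add_mono lift) auto
    also have "4 * ?K * (k * \<bar>d\<bar>) \<le> 4 * ?K * (1 * \<bar>d\<bar>)"
      using k1 Q by (intro mult_left_mono mult_right_mono) auto
    finally show ?thesis by (simp add: algebra_simps)
  qed
  have x7: "X7 \<le> ?K * (10 * (tau * k) + \<bar>d\<bar>)"
  proof -
    have "\<bar>p * \<delta>\<bar> \<le> Q * (4 * Q^2 * tau)" by (rule ab'[OF Q(2) \<delta>2])
    then have "k * (- b1 * (2 * r + 2 * (p * \<delta>) + d)) \<le> k * (Q * (2 * tau + 2 * (Q * (4 * Q^2 * tau)) + \<bar>d\<bar>))"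
      by (intro ab[OF ak] ab'[of "- b1" Q] abs_triangle_ineq[THEN order_trans] add_mono two r order_refl)
        (use Q(7) in simp_all)
    then have "X7 \<le> k * (Q * (2 * tau + 2 * (Q * (4 * Q^2 * tau)) + \<bar>d\<bar>))"
      unfolding X7_def by simp
    also have "\<dots> = 2 * Q * (tau * k) + 8 * Q^4 * (tau * k) + 1 * Q * (k * \<bar>d\<bar>)" by algebra
    also have "\<dots> \<le> 2 * ?K * (tau * k) + 8 * ?K * (tau * k) + 1 * ?K * (k * \<bar>d\<bar>)"
      using Qp tk k by (intro add_mono lift) auto
    also have "1 * ?K * (k * \<bar>d\<bar>) \<le> 1 * ?K * (1 * \<bar>d\<bar>)"
      using k1 Q by (intro mult_left_mono mult_right_mono) auto
    finally show ?thesis by (simp add: algebra_simps)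
  qed
  have x8: "X8 \<le> ?K * (12 * (w * k))"
  proof -
    have "\<bar>(1 + \<delta>) * b0\<bar> \<le> (1 + 4 * Q^2) * Q" by (rule ab'[OF _ Q(6)]) (use \<delta>3 in linarith)
    moreover have "\<bar>p * b1\<bar> \<le> Q * Q" by (rule ab'[OF Q(2) Q(7)])
    ultimately have 1: "\<bar>2 * ((1 + \<delta>) * b0) - 2 * (p * b1)\<bar> \<le> 2 * ((1 + 4 * Q^2) * Q) + 2 * (Q * Q)"
      by linarith
    have "X8 = (w * l) * (2 * ((1 + \<delta>) * b0) - 2 * (p * b1))" unfolding X8_def by algebra
    also have "\<dots> \<le> (w * k) * (2 * ((1 + 4 * Q^2) * Q) + 2 * (Q * Q))"
      by (intro ab[OF ab'[OF _ l] 1]) (use w in simp)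
    also have "\<dots> = 2 * Q * (w * k) + 8 * Q^3 * (w * k) + 2 * Q^2 * (w * k)" by algebra
    also have "\<dots> \<le> 2 * ?K * (w * k) + 8 * ?K * (w * k) + 2 * ?K * (w * k)"
      using Qp tk by (intro add_mono lift) auto
    finally show ?thesis by (simp add: algebra_simps)
  qed
  have x9: "X9 \<le> ?K * (w * k) - w * M * \<bar>d\<bar>"
  proof -
    have "w\<^sup>2 * k * b0 \<le> (w * k) * Q"
    proof -
      have "w * (w * k) * b0 \<le> (1 * (w * k)) * Q"
        by (rule ab[OF ab'[OF _ ab'[OF _ ak]] Q(6)]) (use w in auto)
      then show ?thesis by (simp add: power2_eq_square)
    qed
    also have "\<dots> = 1 * Q * (w * k)" by simp
    also have "\<dots> \<le> 1 * ?K * (w * k)" using Qp tk by (intro lift) auto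
    finally have 1: "w\<^sup>2 * k * b0 \<le> ?K * (w * k)" by simp
    have "0 \<le> w * M * \<bar>d\<bar>" using w M by simp
    \<comment> \<open>The lower bound \<open>1 / 2\<close> of the corrector retains half of
      \<open>2 * w * M * \<bar>d\<bar>\<close>, which is the negative term in the
      conclusion.\<close>
    then have "2 * (w * M * \<bar>d\<bar>) * b0 \<ge> 2 * (w * M * \<bar>d\<bar>) * (1/2)" using b0 by (intro mult_left_mono) auto
    then show ?thesis using 1 unfolding X9_def by (simp add: algebra_simps)
  qed
  have x0: "- S * k \<le> - k" using S1 k mult_right_mono[of 1 S k] by simp
  have "?T \<le> - k + ?K * (17 * (w * k) + 61 * (tau * k) + 23 * \<bar>r\<bar> + 10 * \<bar>d\<bar>) - w * M * \<bar>d\<bar>"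
    unfolding id using x0 x1 x2 x3 x4 x5 x6 x7 x8 x9 by (simp add: algebra_simps)
  also have "?K * (17 * (w * k) + 61 * (tau * k) + 23 * \<bar>r\<bar> + 10 * \<bar>d\<bar>)
      \<le> ?K * (100 * (w * k + tau * k + \<bar>r\<bar> + \<bar>d\<bar>))"
  proof (rule mult_left_mono)
    have "17 * u + 61 * v + 23 * y + 10 * z \<le> 100 * (u + v + y + z)"
      if "0 \<le> u" "0 \<le> v" "0 \<le> y" "0 \<le> z" for u v y z :: real using that by simp
    from this[OF tk(2,1) abs_ge_zero abs_ge_zero]
    show "17 * (w * k) + 61 * (tau * k) + 23 * \<bar>r\<bar> + 10 * \<bar>d\<bar> \<le> 100 * (w * k + tau * k + \<bar>r\<bar> + \<bar>d\<bar>)" .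
  qed (use Q(1) in simp)
  finally show ?thesis by (simp add: algebra_simps)
qed

text \<open>Since \<open>t\<close> has \<open>x\<close>-derivative \<open>- p\<close>, the square of
  \<open>p\<close> in the derivative of \<open>\<Phi>\<close> cancels and the exponent of
  \<open>E\<close> has \<open>x\<close>-derivative \<open>1 + \<delta>\<close>. The smoothed slope
  \<open>p - r\<close> has derivative \<open>w * r\<close>, free of \<open>d\<close>; this is why
  \<open>E\<close> can be differentiated twice in \<open>x\<close> although \<open>d\<close> need
  not be differentiable.\<close>

lemma sheared_laplacian:
  fixes c p d r k l \<Phi> b b1 b2 :: "real \<Rightarrow> real" and w M S :: real
  defines "t \<equiv> \<lambda>x y. y - c x"
  defines "E \<equiv> \<lambda>x y. exp (\<Phi> x + (p x - r x) * t x y)"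
    and "\<delta> \<equiv> \<lambda>x y. r x * (p x + w * t x y) - S * k x"
    and "a' \<equiv> \<lambda>x y. 2 * p x * d x - S * w * l x + w * (d x - w * r x) * t x y - 2 * w * r x * p x
            - (p x - r x) * d x"
    and "g \<equiv> \<lambda>x y. cos (t x y) + k x * b (t x y)"
    and "gx \<equiv> \<lambda>x y. p x * sin (t x y) + w * l x * b (t x y) - p x * k x * b1 (t x y)"
    and "gxx \<equiv> \<lambda>x y. d x * sin (t x y) - (p x)\<^sup>2 * cos (t x y)
          + w * (w * k x - 2 * M * \<bar>d x\<bar>) * b (t x y) - 2 * p x * (w * l x) * b1 (t x y) - d x * k x * b1 (t x y)
          + (p x)\<^sup>2 * k x * b2 (t x y)"
  assumes c: "\<And>x. (c has_real_derivative p x) (at x)"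
    and p: "\<And>x. (p has_real_derivative d x) (at x)"
    and r: "\<And>x. (r has_real_derivative d x - w * r x) (at x)"
    and k: "\<And>x. (k has_real_derivative w * l x) (at x)"
    and l: "\<And>x. (l has_real_derivative w * k x - 2 * M * \<bar>d x\<bar>) (at x)"
    and \<Phi>: "\<And>x. (\<Phi> has_real_derivative 1 + (p x)\<^sup>2 - S * k x) (at x)"
    and b: "\<And>t. (b has_real_derivative b1 t) (at t)" "\<And>t. (b1 has_real_derivative b2 t) (at t)"
  shows "((\<lambda>x. E x y * g x y) has_real_derivative E x y * ((1 + \<delta> x y) * g x y + gx x y)) (at x)" (is ?x)
    and "((\<lambda>x. E x y * ((1 + \<delta> x y) * g x y + gx x y)) has_real_derivative
          E x y * (((1 + \<delta> x y)\<^sup>2 + a' x y) * g x y + 2 * (1 + \<delta> x y) * gx x y + gxx x y)) (at x)" (is ?xx)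
    and "((\<lambda>y. E x y * g x y) has_real_derivative
          E x y * ((p x - r x) * g x y + (k x * b1 (t x y) - sin (t x y)))) (at y)" (is ?y)
    and "((\<lambda>y. E x y * ((p x - r x) * g x y + (k x * b1 (t x y) - sin (t x y)))) has_real_derivative
          E x y * ((p x - r x)\<^sup>2 * g x y + 2 * (p x - r x) * (k x * b1 (t x y) - sin (t x y))
            + (k x * b2 (t x y) - cos (t x y)))) (at y)" (is ?yy)
proof -
  have tx: "((\<lambda>x. t x y) has_real_derivative - p x) (at x)" for x y
    unfolding t_def by (auto intro!: derivative_eq_intros c)
  have ty: "((\<lambda>y. t x y) has_real_derivative 1) (at y)" for x y
    unfolding t_def by (auto intro!: derivative_eq_intros)
  have q: "((\<lambda>x. p x - r x) has_real_derivative w * r x) (at x)" for x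
    by (rule DERIV_cong[OF DERIV_diff[OF p r]]) simp
  have Ex: "((\<lambda>x. E x y) has_real_derivative E x y * (1 + \<delta> x y)) (at x)" for x y
    unfolding E_def by (rule DERIV_cong, (rule derivative_eq_intros \<Phi> q tx refl)+)
      (simp add: \<delta>_def algebra_simps power2_eq_square)
  have Ey: "((\<lambda>y. E x y) has_real_derivative E x y * (p x - r x)) (at y)" for x y
    unfolding E_def by (rule DERIV_cong, (rule derivative_eq_intros ty refl)+) simp
  have \<delta>x: "((\<lambda>x. 1 + \<delta> x y) has_real_derivative a' x y) (at x)" for x y
    unfolding \<delta>_def by (rule DERIV_cong, (rule derivative_eq_intros p r k tx refl)+)
      (simp add: a'_def algebra_simps power2_eq_square)
  note cx = DERIV_chain2[OF DERIV_cos tx] DERIV_chain2[OF DERIV_sin tx] DERIV_chain2[OF b(1) tx] DERIV_chain2[OF b(2) tx]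
  note cy = DERIV_chain2[OF DERIV_cos ty] DERIV_chain2[OF DERIV_sin ty] DERIV_chain2[OF b(1) ty] DERIV_chain2[OF b(2) ty]
  have g_x: "((\<lambda>x. g x y) has_real_derivative gx x y) (at x)" for x y
    unfolding g_def
    by (rule DERIV_cong[OF DERIV_add[OF cx(1) DERIV_mult[OF k cx(3)]]]) (simp add: gx_def algebra_simps)
  have gx_x: "((\<lambda>x. gx x y) has_real_derivative gxx x y) (at x)" for x y
    unfolding gx_def
    by (rule DERIV_cong[OF DERIV_diff[OF DERIV_add[OF DERIV_mult[OF p cx(2)] DERIV_mult[OF DERIV_cmult[OF l] cx(3)]]
            DERIV_mult[OF DERIV_mult[OF p k] cx(4)]]])
      (simp add: gxx_def algebra_simps power2_eq_square)
  have g_y: "((\<lambda>y. g x y) has_real_derivative k x * b1 (t x y) - sin (t x y)) (at y)" for x y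
    unfolding g_def by (rule DERIV_cong[OF DERIV_add[OF cy(1) DERIV_cmult[OF cy(3)]]]) simp
  have gy_y: "((\<lambda>y. k x * b1 (t x y) - sin (t x y)) has_real_derivative k x * b2 (t x y) - cos (t x y)) (at y)" for x y
    by (rule DERIV_cong[OF DERIV_diff[OF DERIV_cmult[OF cy(4)] cy(2)]]) simp
  show ?x by (rule DERIV_cong[OF DERIV_mult[OF Ex g_x]]) (simp add: algebra_simps)
  show ?xx by (rule DERIV_cong[OF DERIV_mult[OF Ex DERIV_add[OF DERIV_mult[OF \<delta>x g_x] gx_x]]])
      (simp add: algebra_simps power2_eq_square)
  show ?y by (rule DERIV_cong[OF DERIV_mult[OF Ey g_y]]) (simp add: algebra_simps)
  show ?yy by (rule DERIV_cong[OF DERIV_mult[OF Ey DERIV_add[OF DERIV_cmult[OF g_y] gy_y]]])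
      (simp add: algebra_simps power2_eq_square)
qed

section \<open>The corrector and the construction of the barrier\<close>

text \<open>The right-hand side is even, and its derivative \<open>t * cos t - sin t\<close> is
  nonpositive for \<open>0 \<le> t \<le> pi / 2\<close>, so the least value is the one at the end
  point. As it exceeds 3/2, the corrector stays above 1/2 after the subtraction of 1.\<close>

lemma x_sin_plus_cos_ge:
  fixes t :: real
  assumes "\<bar>t\<bar> \<le> pi / 2"
  shows "pi / 2 \<le> t * sin t + 2 * cos t"
proof -
  have *: "pi / 2 \<le> t * sin t + 2 * cos t" if t: "0 \<le> t" "t \<le> pi / 2" for t :: real
  proof -
    have sin_ge: "u * cos u \<le> sin u" if "0 \<le> u" "u \<le> pi / 2" for u :: real
    proof -
      have "sin 0 - 0 * cos 0 \<le> sin u - u * cos u"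
      proof (rule DERIV_nonneg_imp_nondecreasing[OF that(1)])
        fix z assume z: "0 \<le> z" "z \<le> u"
        have "((\<lambda>x. sin x - x * cos x) has_real_derivative z * sin z) (at z)"
          by (auto intro!: derivative_eq_intros)
        then show "\<exists>y. ((\<lambda>x. sin x - x * cos x) has_real_derivative y) (at z) \<and> 0 \<le> y"
          using z that by (intro exI[of _ "z * sin z"]) (auto intro!: mult_nonneg_nonneg sin_ge_zero)
      qed
      then show ?thesis by simp
    qed
    have "pi / 2 * sin (pi / 2) + 2 * cos (pi / 2) \<le> t * sin t + 2 * cos t"
    proof (rule DERIV_nonpos_imp_nonincreasing[OF t(2)])
      fix z assume z: "t \<le> z" "z \<le> pi / 2"
      have "((\<lambda>x. x * sin x + 2 * cos x) has_real_derivative z * cos z - sin z) (at z)"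
        by (auto intro!: derivative_eq_intros)
      then show "\<exists>y. ((\<lambda>x. x * sin x + 2 * cos x) has_real_derivative y) (at z) \<and> y \<le> 0"
        using sin_ge[of z] z t by (intro exI[of _ "z * cos z - sin z"]) auto
    qed
    then show ?thesis by simp
  qed
  show ?thesis
  proof (cases "0 \<le> t")
    case False
    then show ?thesis using *[of "- t"] assms by simp
  qed (use * assms in auto)
qed

text \<open>The corrector \<open>b\<close> solves \<open>b'' + b = 2 * cos t + 2 * L * sin t - 1\<close>; its homogeneous part is chosen to
  make it positive on the closed strip, where \<open>cos t\<close> alone vanishes on the edges.\<close>

lemma corrector_bounds:
  fixes L t :: real
  assumes t: "\<bar>t\<bar> \<le> pi / 2"
  shows "1 / 2 \<le> t * sin t - 1 + (2 + 2 * \<bar>L\<bar> - L * t) * cos t"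
    and "\<bar>t * sin t - 1 + (2 + 2 * \<bar>L\<bar> - L * t) * cos t\<bar> \<le> 5 + 5 * \<bar>L\<bar>"
    and "\<bar>sin t + t * cos t - L * cos t - (2 + 2 * \<bar>L\<bar> - L * t) * sin t\<bar> \<le> 5 + 5 * \<bar>L\<bar>"
proof -
  have t2: "\<bar>t\<bar> \<le> 2" using t pi_less_4 by linarith
  have Lt: "\<bar>L * t\<bar> \<le> 2 * \<bar>L\<bar>"
    using mult_left_mono[OF t2, of "\<bar>L\<bar>"] by (simp add: abs_mult mult.commute)
  have cos: "0 \<le> cos t" using t by (intro cos_ge_zero) auto
  have "2 * cos t \<le> (2 + 2 * \<bar>L\<bar> - L * t) * cos t"
    using Lt cos by (intro mult_right_mono) auto
  then show "1 / 2 \<le> t * sin t - 1 + (2 + 2 * \<bar>L\<bar> - L * t) * cos t"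
    using x_sin_plus_cos_ge[OF t] pi_gt3 by linarith
  have bd: "\<bar>x * y\<bar> \<le> c" if "\<bar>x\<bar> \<le> c" "\<bar>y\<bar> \<le> 1" for x y c :: real
    using mult_mono[OF that] that by (simp add: abs_mult)
  have D: "\<bar>2 + 2 * \<bar>L\<bar> - L * t\<bar> \<le> 2 + 4 * \<bar>L\<bar>" using Lt by linarith
  have "\<bar>t * sin t\<bar> \<le> 2" "\<bar>(2 + 2 * \<bar>L\<bar> - L * t) * cos t\<bar> \<le> 2 + 4 * \<bar>L\<bar>"
    by (intro bd t2 D abs_sin_le_one abs_cos_le_one)+
  then show "\<bar>t * sin t - 1 + (2 + 2 * \<bar>L\<bar> - L * t) * cos t\<bar> \<le> 5 + 5 * \<bar>L\<bar>" by linarith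
  have "\<bar>sin t\<bar> \<le> 1" "\<bar>t * cos t\<bar> \<le> 2" "\<bar>L * cos t\<bar> \<le> \<bar>L\<bar>"
    "\<bar>(2 + 2 * \<bar>L\<bar> - L * t) * sin t\<bar> \<le> 2 + 4 * \<bar>L\<bar>"
    by (intro bd t2 D abs_sin_le_one abs_cos_le_one order_refl)+
  then show "\<bar>sin t + t * cos t - L * cos t - (2 + 2 * \<bar>L\<bar> - L * t) * sin t\<bar> \<le> 5 + 5 * \<bar>L\<bar>" by linarith
qed

text \<open>Any point where \<open>I\<close> is within \<open>e\<close> of its supremum over the
  half-line will do. This provides the abscissa beyond which the slope has small total
  variation.\<close>

lemma small_tail:
  fixes I :: "real \<Rightarrow> real"
  assumes I: "mono I" and bd: "\<And>x. 0 \<le> x \<Longrightarrow> I x \<le> T" and e: "0 < e"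
  obtains a where "0 \<le> a" "\<And>x. a \<le> x \<Longrightarrow> I x - I a \<le> e"
proof -
  have bdd: "bdd_above (I ` {0..})" using bd by (intro bdd_aboveI2[of _ _ T]) auto
  obtain a where a: "0 \<le> a" "Sup (I ` {0..}) - e < I a"
    using less_cSup_iff[of "I ` {0..}" "Sup (I ` {0..}) - e"] bdd e by auto
  have "I x - I a \<le> e" if "a \<le> x" for x
    using cSup_upper[of "I x" "I ` {0..}"] bdd a that by (smt (verit) atLeast_iff imageI)
  with a show thesis using that by blast
qed

text \<open>The barrier is the function of \<open>sheared_laplacian\<close>, and
  \<open>laplacian_factor_le\<close> gives the sign. Its weight \<open>k\<close>, hence
  \<open>V\<close> itself, depends on \<open>X\<close>, but \<open>a\<close>, \<open>A\<close> and
  \<open>C\<close> are fixed first; this uniformity lets \<open>X\<close> tend to infinity in the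
  application.\<close>

lemma growing_superharmonic_exists:
  fixes c p d I G :: "real \<Rightarrow> real"
  assumes c: "\<And>x. (c has_real_derivative p x) (at x)"
    and p: "\<And>x. (p has_real_derivative d x) (at x)" and d: "continuous_on UNIV d"
    and I: "\<And>x. (I has_real_derivative \<bar>d x\<bar>) (at x)"
    and G: "\<And>x. (G has_real_derivative (p x)\<^sup>2) (at x)"
    and bd: "\<And>x. 0 \<le> x \<Longrightarrow> I x \<le> T"
  obtains a A C where "0 \<le> a" "0 < A"
    "\<And>X. a \<le> X \<Longrightarrow> \<exists>V Vx Vxx Vy Vyy.
      continuous_on UNIV V \<and>
      (\<forall>x y. ((\<lambda>x. V (Complex x y)) has_real_derivative Vx (Complex x y)) (at x)) \<and>
      (\<forall>x y. ((\<lambda>x. Vx (Complex x y)) has_real_derivative Vxx (Complex x y)) (at x)) \<and>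
      (\<forall>x y. ((\<lambda>y. V (Complex x y)) has_real_derivative Vy (Complex x y)) (at y)) \<and>
      (\<forall>x y. ((\<lambda>y. Vy (Complex x y)) has_real_derivative Vyy (Complex x y)) (at y)) \<and>
      (\<forall>x y. a \<le> x \<longrightarrow> x \<le> X \<longrightarrow> \<bar>y - c x\<bar> \<le> pi / 2 \<longrightarrow>
         Vxx (Complex x y) + Vyy (Complex x y) < 0 \<and> 0 \<le> V (Complex x y) \<and>
         V (Complex x y) \<le> C * exp (x + G x)) \<and>
      (\<forall>y. \<bar>y - c X\<bar> \<le> pi / 2 \<longrightarrow> A * exp (X + G X) \<le> V (Complex X y))"
proof -
  define P where "P = \<bar>p 0\<bar> + (T - I 0)"
  have pV: "\<bar>p x - p a\<bar> \<le> I x - I a" if "a \<le> x" for a x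
    using that by (intro abs_diff_le_variation[OF p I]) auto
  have P: "\<bar>p x\<bar> \<le> P" if "0 \<le> x" for x using pV[OF that] bd[OF that] by (simp add: P_def)
  have P0: "0 \<le> P" using P[of 0] by linarith
  \<comment> \<open>\<open>Q\<close> dominates the slope, \<open>pi / 2\<close> and the corrector
    bound \<open>5 + 5 * \<bar>L\<bar>\<close>; \<open>K\<close> is the error constant of
    \<open>laplacian_factor_le\<close>. With this \<open>w\<close> the two errors
    \<open>K * w * k\<close> amount to \<open>k / 2\<close>; \<open>w * M = K\<close> cancels
    \<open>K * \<bar>d\<bar>\<close>; and \<open>4 * K \<le> M\<close> together with
    \<open>M * \<bar>r\<bar> \<le> k\<close> leaves at most \<open>k / 4\<close> for
    \<open>K * \<bar>r\<bar>\<close>. In total at most \<open>- k / 4\<close> remains.\<close>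
  define Q where "Q = 10 + 10 * P"
  define K where "K = 100 * Q ^ 5"
  define w where "w = 1 / (4 * K)"
  define M where "M = 4 * K\<^sup>2"
  have Q1: "1 \<le> Q" using P0 by (simp add: Q_def)
  have "1 \<le> Q ^ 5" using Q1 by simp
  then have K1: "1 \<le> K" unfolding K_def by simp
  have w: "0 < w" "w \<le> 1" using K1 by (auto simp: w_def field_simps)
  have wM: "w * M = K" using K1 by (simp add: w_def M_def power2_eq_square)
  have M1: "4 * K \<le> M" "1 \<le> M"
  proof -
    have "K * 1 \<le> K * K" using K1 by (intro mult_left_mono) auto
    then show "4 * K \<le> M" "1 \<le> M" using K1 unfolding M_def power2_eq_square by linarith+
  qed
  have "mono I"
    by (intro monoI DERIV_nonneg_imp_nondecreasing[of _ _ I]) (auto intro: I)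
  \<comment> \<open>Beyond \<open>a\<close> the quantity \<open>M * (I x - I a)\<close> is at most
    \<open>w / 2\<close>. With the smoothing parameter \<open>e = w / 2\<close> this gives
    \<open>k \<le> w\<close>, and \<open>w\<close> also bounds \<open>\<bar>r\<bar>\<close> and
    \<open>\<bar>p - L\<bar>\<close>, so it can serve as \<open>tau\<close>.\<close>
  then obtain a where a: "0 \<le> a" "\<And>x. a \<le> x \<Longrightarrow> I x - I a \<le> w / (2 * M)"
    using small_tail[of I T "w / (2 * M)"] bd w M1 by auto
  have Ia: "M * (I x - I a) \<le> w / 2" "I x - I a \<le> w" if "a \<le> x" for x
  proof -
    have "M * (I x - I a) \<le> M * (w / (2 * M))" using a(2)[OF that] M1 by (intro mult_left_mono) auto
    then show "M * (I x - I a) \<le> w / 2" using M1 by simp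
    have "w / (2 * M) \<le> w / 1" using w M1 by (intro divide_left_mono) auto
    then show "I x - I a \<le> w" using a(2)[OF that] by simp
  qed
  define L where "L = p a"
  define S where "S = 1 + L\<^sup>2"
  define b where "b = (\<lambda>t. t * sin t - 1 + (2 + 2 * \<bar>L\<bar> - L * t) * cos t)"
  define b1 where "b1 = (\<lambda>t. sin t + t * cos t - L * cos t - (2 + 2 * \<bar>L\<bar> - L * t) * sin t)"
  define b2 where "b2 = (\<lambda>t. 2 * cos t + 2 * L * sin t - 1 - b t)"
  have b': "(b has_real_derivative b1 t) (at t)" for t
    unfolding b_def by (auto intro!: derivative_eq_intros simp: b1_def algebra_simps)
  have b1': "(b1 has_real_derivative b2 t) (at t)" for t
    unfolding b1_def by (auto intro!: derivative_eq_intros simp: b2_def b_def algebra_simps)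
  have LP: "\<bar>L\<bar> \<le> P" using P[OF a(1)] by (simp add: L_def)
  have b_bd: "1 / 2 \<le> b t" "\<bar>b t\<bar> \<le> Q" "\<bar>b1 t\<bar> \<le> Q" if "\<bar>t\<bar> \<le> pi / 2" for t
    using corrector_bounds[OF that, of L] LP P0 unfolding b_def b1_def Q_def by linarith+
  define W where "W = 2 * S / w"
  have S0: "0 \<le> S / w" using w by (simp add: S_def)
  \<comment> \<open>In both constants \<open>W\<close> allows for the distance of
    \<open>\<Phi> x\<close> from \<open>x + G x\<close>, and \<open>Q * Q\<close> for the term
    \<open>(p x - r x) * t x y\<close>. The factor \<open>w / 4\<close> is the product of the lower
    bounds \<open>w / 2\<close> of \<open>k X\<close> and \<open>1 / 2\<close> of \<open>b\<close>,
    which survives on the edges where the cosine vanishes; \<open>1 + Q\<close> bounds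
    \<open>cos t + k * b\<close>.\<close>
  show thesis
  proof (rule that[of a "exp (- W - Q * Q) * (w / 4)" "exp (W + Q * Q) * (1 + Q)"])
    fix X assume aX: "a \<le> X"
    have M0: "0 \<le> M" and w2: "0 < w / 2" using M1 w by auto
    obtain r k l where r: "\<And>x. (r has_real_derivative d x - w * r x) (at x)"
      and k: "\<And>x. (k has_real_derivative w * l x) (at x)"
      and l: "\<And>x. (l has_real_derivative w * k x - 2 * M * \<bar>d x\<bar>) (at x)"
      and kX: "w / 2 \<le> k X"
      and rkl: "\<And>x. a \<le> x \<Longrightarrow> x \<le> X \<Longrightarrow> 0 < k x \<and> \<bar>l x\<bar> \<le> k x \<and> M * \<bar>r x\<bar> \<le> k x
        \<and> \<bar>r x\<bar> \<le> I x - I a \<and> k x \<le> w / 2 + M * (I X - I a)"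
      by (rule exponential_smoothing[OF d I w(1) M0 w2 aX]) (rule that; assumption)
    have k_le: "k x \<le> w" if "a \<le> x" "x \<le> X" for x
      using rkl[OF that] Ia(1)[OF aX] by linarith
    have r_le: "\<bar>r x\<bar> \<le> w" if "a \<le> x" "x \<le> X" for x
      using rkl[OF that] Ia(2)[OF that(1)] by linarith
    \<comment> \<open>Because \<open>l' = w * k - 2 * M * \<bar>d\<bar>\<close>, the bracket divided
      by \<open>w\<close> is an antiderivative of \<open>k\<close>. It is bounded on
      \<open>{a..X}\<close> independently of \<open>X\<close>, so the correction
      \<open>- S * k\<close> changes the exponent by at most \<open>W\<close> and the growth of
      \<open>G\<close> is preserved.\<close>
    define \<Phi> where "\<Phi> = (\<lambda>x. x + G x - S / w * (2 * (M * (I x - I a)) + l x))"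
    have \<Phi>: "(\<Phi> has_real_derivative 1 + (p x)\<^sup>2 - S * k x) (at x)" for x
      unfolding \<Phi>_def using w
      by (auto intro!: derivative_eq_intros G I l simp: field_simps)
    have \<Phi>_bd: "\<bar>\<Phi> x - (x + G x)\<bar> \<le> W" if "a \<le> x" "x \<le> X" for x
    proof -
      have "0 \<le> M * (I x - I a)" using pV[OF that(1)] M1 by (intro mult_nonneg_nonneg) auto
      then have "\<bar>2 * (M * (I x - I a)) + l x\<bar> \<le> 2"
        using Ia(1)[OF that(1)] rkl[OF that] k_le[OF that] w by (simp add: abs_le_iff)
      then have "S / w * \<bar>2 * (M * (I x - I a)) + l x\<bar> \<le> S / w * 2" using S0 by (rule mult_left_mono)
      then show ?thesis using w by (simp add: \<Phi>_def W_def abs_mult S_def mult.commute)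
    qed
    have q_le: "\<bar>p x - r x\<bar> \<le> Q" "\<bar>p x\<bar> \<le> Q" if "a \<le> x" "x \<le> X" for x
      using P[of x] r_le[OF that] that a(1) w P0 unfolding Q_def by linarith+
    define t where "t = (\<lambda>x y. y - c x)"
    define E where "E = (\<lambda>x y. exp (\<Phi> x + (p x - r x) * t x y))"
    define g where "g = (\<lambda>x y. cos (t x y) + k x * b (t x y))"
    define V where "V = (\<lambda>w. E (Re w) (Im w) * g (Re w) (Im w))"
    note lap = sheared_laplacian[OF c p r k l \<Phi> b' b1']
    have cont: "continuous_on UNIV f" if "\<And>x. (f has_real_derivative f' x) (at x)" for f f' :: "real \<Rightarrow> real"
      using that by (intro DERIV_continuous_on) (auto intro: has_field_derivative_at_within)
    have contRe: "continuous_on UNIV (\<lambda>w. f (Re w))" if "\<And>x. (f has_real_derivative f' x) (at x)" for f f' :: "real \<Rightarrow> real"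
      by (rule continuous_on_compose2[OF cont[OF that]]) (auto intro!: continuous_intros)
    have ct: "continuous_on UNIV (\<lambda>w. t (Re w) (Im w))"
      unfolding t_def by (intro continuous_intros contRe[OF c])
    have "continuous_on UNIV V"
      unfolding V_def E_def g_def
      by (intro continuous_intros ct contRe[OF \<Phi>] contRe[OF p] contRe[OF r] contRe[OF k]
          continuous_on_compose2[OF cont[OF b'] ct]) auto
    have tQ: "\<bar>s\<bar> \<le> Q" if "\<bar>s\<bar> \<le> pi / 2" for s using that pi_less_4 P0 unfolding Q_def by linarith
    have qt: "\<bar>(p x - r x) * t x y\<bar> \<le> Q * Q" if "a \<le> x" "x \<le> X" "\<bar>t x y\<bar> \<le> pi / 2" for x y
      unfolding abs_mult using q_le[OF that(1,2)] tQ[OF that(3)] by (intro mult_mono) auto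
    have cos0: "0 \<le> cos s" if "\<bar>s\<bar> \<le> pi / 2" for s :: real using that by (intro cos_ge_zero) auto
    define \<delta> where "\<delta> = (\<lambda>x y. r x * (p x + w * t x y) - S * k x)"
    define a' where "a' = (\<lambda>x y. 2 * p x * d x - S * w * l x + w * (d x - w * r x) * t x y
      - 2 * w * r x * p x - (p x - r x) * d x)"
    define gx where "gx = (\<lambda>x y. p x * sin (t x y) + w * l x * b (t x y) - p x * k x * b1 (t x y))"
    define gxx where "gxx = (\<lambda>x y. d x * sin (t x y) - (p x)\<^sup>2 * cos (t x y)
      + w * (w * k x - 2 * M * \<bar>d x\<bar>) * b (t x y) - 2 * p x * (w * l x) * b1 (t x y) - d x * k x * b1 (t x y)
      + (p x)\<^sup>2 * k x * b2 (t x y))"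
    define gy where "gy = (\<lambda>x y. k x * b1 (t x y) - sin (t x y))"
    define gyy where "gyy = (\<lambda>x y. k x * b2 (t x y) - cos (t x y))"
    define Vx where "Vx = (\<lambda>w. (\<lambda>x y. E x y * ((1 + \<delta> x y) * g x y + gx x y)) (Re w) (Im w))"
    define Vxx where "Vxx = (\<lambda>w. (\<lambda>x y. E x y * (((1 + \<delta> x y)\<^sup>2 + a' x y) * g x y
      + 2 * (1 + \<delta> x y) * gx x y + gxx x y)) (Re w) (Im w))"
    define Vy where "Vy = (\<lambda>w. (\<lambda>x y. E x y * ((p x - r x) * g x y + gy x y)) (Re w) (Im w))"
    define Vyy where "Vyy = (\<lambda>w. (\<lambda>x y. E x y * ((p x - r x)\<^sup>2 * g x y
      + 2 * (p x - r x) * gy x y + gyy x y)) (Re w) (Im w))"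
    note V_defs = V_def Vx_def Vxx_def Vy_def Vyy_def E_def g_def gx_def gxx_def gy_def gyy_def \<delta>_def a'_def t_def
    show "\<exists>V Vx Vxx Vy Vyy.
      continuous_on UNIV V \<and>
      (\<forall>x y. ((\<lambda>x. V (Complex x y)) has_real_derivative Vx (Complex x y)) (at x)) \<and>
      (\<forall>x y. ((\<lambda>x. Vx (Complex x y)) has_real_derivative Vxx (Complex x y)) (at x)) \<and>
      (\<forall>x y. ((\<lambda>y. V (Complex x y)) has_real_derivative Vy (Complex x y)) (at y)) \<and>
      (\<forall>x y. ((\<lambda>y. Vy (Complex x y)) has_real_derivative Vyy (Complex x y)) (at y)) \<and>
      (\<forall>x y. a \<le> x \<longrightarrow> x \<le> X \<longrightarrow> \<bar>y - c x\<bar> \<le> pi / 2 \<longrightarrow>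
         Vxx (Complex x y) + Vyy (Complex x y) < 0 \<and> 0 \<le> V (Complex x y) \<and>
         V (Complex x y) \<le> exp (W + Q * Q) * (1 + Q) * exp (x + G x)) \<and>
      (\<forall>y. \<bar>y - c X\<bar> \<le> pi / 2 \<longrightarrow> exp (- W - Q * Q) * (w / 4) * exp (X + G X) \<le> V (Complex X y))"
    proof (rule exI[of _ V], rule exI[of _ Vx], rule exI[of _ Vxx], rule exI[of _ Vy], rule exI[of _ Vyy],
        intro conjI allI impI)
      show "continuous_on UNIV V" by fact
      show "((\<lambda>x. V (Complex x y)) has_real_derivative Vx (Complex x y)) (at x)" for x y
        unfolding V_defs complex.sel by (rule lap(1))
      show "((\<lambda>x. Vx (Complex x y)) has_real_derivative Vxx (Complex x y)) (at x)" for x y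
        unfolding V_defs complex.sel by (rule lap(2))
      show "((\<lambda>y. V (Complex x y)) has_real_derivative Vy (Complex x y)) (at y)" for x y
        unfolding V_defs complex.sel by (rule lap(3))
      show "((\<lambda>y. Vy (Complex x y)) has_real_derivative Vyy (Complex x y)) (at y)" for x y
        unfolding V_defs complex.sel by (rule lap(4))
    next
      fix x y assume x: "a \<le> x" "x \<le> X" and y: "\<bar>y - c x\<bar> \<le> pi / 2"
      then have t: "\<bar>t x y\<bar> \<le> pi / 2" by (simp add: t_def)
      note kx = rkl[OF x] and bt = b_bd[OF t]
      have "\<bar>p x - L\<bar> \<le> w" using pV[OF x(1)] Ia(2)[OF x(1)] by (simp add: L_def)
      moreover have "\<bar>L\<bar> \<le> Q" using LP P0 by (simp add: Q_def)
      \<comment> \<open>\<open>tau\<close> is taken to be \<open>w\<close>, whence the doubled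
        \<open>w * k x\<close> on the right.\<close>
      ultimately have neg: "((1 + (r x * (p x + w * t x y) - S * k x))\<^sup>2
            + (2 * p x * d x - S * w * l x + w * (d x - w * r x) * t x y - 2 * w * r x * p x - (p x - r x) * d x)
            + (p x - r x)\<^sup>2) * (cos (t x y) + k x * b (t x y))
          + 2 * (1 + (r x * (p x + w * t x y) - S * k x)) * (p x * sin (t x y) + w * l x * b (t x y) - p x * k x * b1 (t x y))
          + (d x * sin (t x y) - (p x)\<^sup>2 * cos (t x y) + w * (w * k x - 2 * M * \<bar>d x\<bar>) * b (t x y)
            - 2 * p x * (w * l x) * b1 (t x y) - d x * k x * b1 (t x y)
            + (p x)\<^sup>2 * k x * (2 * cos (t x y) + 2 * L * sin (t x y) - 1 - b (t x y)))
          + 2 * (p x - r x) * (k x * b1 (t x y) - sin (t x y))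
          + (k x * (2 * cos (t x y) + 2 * L * sin (t x y) - 1 - b (t x y)) - cos (t x y))
        \<le> - k x + 100 * Q ^ 5 * (w * k x + w * k x + \<bar>r x\<bar> + \<bar>d x\<bar>) - w * M * \<bar>d x\<bar>" (is "?T \<le> ?R")
        using kx k_le[OF x] r_le[OF x] w Q1 q_le[OF x] tQ[OF t] bt M1
        by (intro laplacian_factor_le[OF refl S_def]) auto
      have "?R < 0"
      proof -
        have "K * \<bar>r x\<bar> \<le> k x / 4"
        proof -
          have "4 * K * \<bar>r x\<bar> \<le> M * \<bar>r x\<bar>" using M1 by (intro mult_right_mono) auto
          then show ?thesis using kx by linarith
        qed
        moreover have "K * (w * k x) = k x / 4" using K1 by (simp add: w_def)
        moreover have "?R = - k x + 2 * (K * (w * k x)) + K * \<bar>r x\<bar>"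
          unfolding K_def[symmetric] wM by (simp add: algebra_simps)
        ultimately show ?thesis using kx by linarith
      qed
      with neg have T0: "?T < 0" by (rule le_less_trans)
      have E0: "0 < E x y" by (simp add: E_def)
      show "Vxx (Complex x y) + Vyy (Complex x y) < 0" (is "?V < 0")
      proof -
        have "?V = E x y * ?T"
          unfolding Vxx_def Vyy_def complex.sel gxx_def gx_def gy_def gyy_def \<delta>_def a'_def b2_def g_def
          by algebra
        then show ?thesis using mult_pos_neg[OF E0 T0] by simp
      qed
      have g0: "0 \<le> g x y" using cos0[OF t] kx bt(1) by (simp add: g_def)
      then show "0 \<le> V (Complex x y)" using E0 by (simp add: V_def)
      have "k x * b (t x y) \<le> 1 * Q" using kx k_le[OF x] w bt Q1 by (intro mult_mono) auto
      then have g1: "g x y \<le> 1 + Q" using cos_le_one[of "t x y"] unfolding g_def by linarith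
      have "\<Phi> x + (p x - r x) * t x y \<le> W + Q * Q + (x + G x)"
        using \<Phi>_bd[OF x] qt[OF x t] by linarith
      then have "E x y \<le> exp (W + Q * Q) * exp (x + G x)" by (simp add: E_def flip: exp_add)
      from mult_mono[OF this g1 _ g0]
      show "V (Complex x y) \<le> exp (W + Q * Q) * (1 + Q) * exp (x + G x)"
        by (simp add: V_def ac_simps)
    next
      fix y assume y: "\<bar>y - c X\<bar> \<le> pi / 2"
      then have t: "\<bar>t X y\<bar> \<le> pi / 2" by (simp add: t_def)
      have "w / 2 * (1 / 2) \<le> k X * b (t X y)" using kX w b_bd(1)[OF t] by (intro mult_mono) auto
      then have g1: "w / 4 \<le> g X y" using cos0[OF t] unfolding g_def by linarith
      have "- W - Q * Q + (X + G X) \<le> \<Phi> X + (p X - r X) * t X y"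
        using \<Phi>_bd[OF aX order_refl] qt[OF aX order_refl t] by linarith
      then have "exp (- W - Q * Q) * exp (X + G X) \<le> E X y" by (simp add: E_def flip: exp_add)
      moreover have "0 \<le> E X y" "0 \<le> w / 4" using w by (simp_all add: E_def)
      ultimately have "exp (- W - Q * Q) * exp (X + G X) * (w / 4) \<le> E X y * g X y"
        using g1 by (intro mult_mono)
      then show "exp (- W - Q * Q) * (w / 4) * exp (X + G X) \<le> V (Complex X y)"
        by (simp add: V_def ac_simps)
    qed
  qed (use a w in auto)
qed

section \<open>Half-line integrals and logarithmic coordinates\<close>

text \<open>The fundamental theorem on \<open>{a..x}\<close> bounds \<open>F\<close> by the
  integral; conversely a bounded nondecreasing \<open>F\<close> has a limit, which evaluates the
  integral. The two integral hypotheses thereby become boundedness and unboundedness of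
  antiderivatives.\<close>

lemma half_line_integral_bounded_iff:
  fixes F f :: "real \<Rightarrow> real"
  assumes F: "\<And>x. (F has_real_derivative f x) (at x)" and f: "continuous_on UNIV f" "\<And>x. 0 \<le> f x"
  shows "(\<integral>\<^sup>+x\<in>{a..}. ennreal (f x) \<partial>lborel) < \<infinity> \<longleftrightarrow> (\<exists>T. \<forall>x\<ge>a. F x \<le> T)"
proof -
  have meas: "f \<in> borel_measurable borel" using f by (simp add: borel_measurable_continuous_onI)
  have mono: "F x \<le> F y" if "x \<le> y" for x y
    using F f by (intro DERIV_nonneg_imp_nondecreasing[OF that]) auto
  show ?thesis
  proof
    assume fin: "(\<integral>\<^sup>+x\<in>{a..}. ennreal (f x) \<partial>lborel) < \<infinity>"
    then obtain r where r: "0 \<le> r" "(\<integral>\<^sup>+x\<in>{a..}. ennreal (f x) \<partial>lborel) = ennreal r"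
      by (metis ennreal_cases infinity_ennreal_def less_irrefl)
    have "F x \<le> F a + r" if "a \<le> x" for x
    proof -
      have "ennreal (F x - F a) = (\<integral>\<^sup>+x\<in>{a..x}. ennreal (f x) \<partial>lborel)"
        using F f meas that
        by (intro nn_integral_FTC_Icc[symmetric]) (auto simp: has_real_derivative_iff_has_vector_derivative
            intro: has_vector_derivative_at_within)
      also have "\<dots> \<le> (\<integral>\<^sup>+x\<in>{a..}. ennreal (f x) \<partial>lborel)"
        by (intro nn_integral_mono) (auto simp: indicator_def)
      finally show ?thesis using r by simp
    qed
    then show "\<exists>T. \<forall>x\<ge>a. F x \<le> T" by auto
  next
    assume "\<exists>T. \<forall>x\<ge>a. F x \<le> T"
    then obtain T where T: "\<And>x. a \<le> x \<Longrightarrow> F x \<le> T" by auto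
    have bdd: "bdd_above (F ` {a..})" using T by (intro bdd_aboveI2) auto
    have "(F \<longlongrightarrow> Sup (F ` {a..})) at_top"
    proof (rule order_tendstoI)
      fix y assume "y < Sup (F ` {a..})"
      then obtain b where "b \<ge> a" "y < F b" using less_cSup_iff[OF _ bdd] by auto
      then show "\<forall>\<^sub>F x in at_top. y < F x"
        using mono by (intro eventually_at_top_linorderI[of b]) (meson less_le_trans)
    next
      fix y assume "Sup (F ` {a..}) < y"
      then show "\<forall>\<^sub>F x in at_top. F x < y"
        using cSup_upper[OF _ bdd] by (intro eventually_at_top_linorderI[of a]) (meson atLeast_iff imageI le_less_trans)
    qed
    from nn_integral_FTC_atLeast[OF meas F f(2) this]
    show "(\<integral>\<^sup>+x\<in>{a..}. ennreal (f x) \<partial>lborel) < \<infinity>" by simp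
  qed
qed

text \<open>On the circle of radius \<open>exp x\<close> the bound holds on an open arc and passes
  to the two end points by continuity.\<close>

lemma bounded_strip:
  fixes f :: "complex \<Rightarrow> complex"
  assumes f: "continuous_on UNIV f" and bd: "\<And>z. z \<in> rotating_half_plane s \<Longrightarrow> norm (f z) \<le> M"
    and y: "s (exp x) \<le> y" "y \<le> s (exp x) + pi"
  shows "norm (f (exp (Complex x y))) \<le> M"
proof -
  have "norm (f (of_real (exp x) * cis v)) \<le> M" if "v \<in> {s (exp x)<..<s (exp x) + pi}" for v
    using that by (intro bd) (force simp: rotating_half_plane_def)
  moreover have "continuous_on (closure {s (exp x)<..<s (exp x) + pi}) (\<lambda>v. f (of_real (exp x) * cis v))"
    by (intro continuous_on_compose2[OF f] continuous_intros) auto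
  ultimately have "norm (f (of_real (exp x) * cis y)) \<le> M"
    using y by (intro continuous_on_closure_norm_le[where s = "{s (exp x)<..<s (exp x) + pi}"]) auto
  then show ?thesis by (simp add: exp_eq_polar)
qed


lemma exp_Complex_shift: "exp (Complex x (y + 2 * pi * of_int n)) = exp (Complex x y)"
  unfolding exp_eq by (rule exI[of _ n]) (simp add: complex_eq_iff)

text \<open>The integral hypotheses speak of \<open>deriv h\<close> and
  \<open>deriv (deriv h)\<close>, so the chain rule derivatives \<open>p\<close> and
  \<open>d\<close> are identified with these. As \<open>exp\<close> maps the line into
  \<open>{0<..}\<close>, no restriction on \<open>x\<close> remains.\<close>

lemma half_plane_C2_log:
  fixes s h :: "real \<Rightarrow> real"
  assumes s: "s C2_differentiable_on {0<..}" and h: "\<And>x. h x = s (exp x)"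
  obtains "\<And>x. (h has_real_derivative deriv h x) (at x)"
    "\<And>x. (deriv h has_real_derivative deriv (deriv h) x) (at x)"
    "continuous_on UNIV (deriv (deriv h))"
proof -
  obtain s1 where s1: "\<And>x. 0 < x \<Longrightarrow> (s has_real_derivative s1 x) (at x)"
    using s by (auto simp: C2_differentiable_on_def C1_differentiable_on_def
        has_real_derivative_iff_has_vector_derivative[symmetric])
  have D: "deriv s x = s1 x" if "0 < x" for x using s1[OF that] by (rule DERIV_imp_deriv)
  obtain s2 where s2: "\<And>x. 0 < x \<Longrightarrow> (deriv s has_real_derivative s2 x) (at x)"
    "continuous_on {0<..} s2"
    using s by (auto simp: C2_differentiable_on_def C1_differentiable_on_def
        has_real_derivative_iff_has_vector_derivative[symmetric])
  define p where "p = (\<lambda>x. deriv s (exp x) * exp x)"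
  define d where "d = (\<lambda>x. s2 (exp x) * exp x * exp x + deriv s (exp x) * exp x)"
  have hh: "h = (\<lambda>x. s (exp x))" using h by auto
  have p: "(h has_real_derivative p x) (at x)" for x
    unfolding hh p_def using DERIV_chain2[OF s1 DERIV_exp] D by simp
  have d: "(p has_real_derivative d x) (at x)" for x
    unfolding p_def d_def
    by (rule DERIV_cong[OF DERIV_mult[OF DERIV_chain2[OF s2(1) DERIV_exp] DERIV_exp]]) (auto simp: algebra_simps)
  have "deriv h = p" using p by (auto intro: DERIV_imp_deriv)
  moreover have "deriv p = d" using d by (auto intro: DERIV_imp_deriv)
  moreover have "continuous_on UNIV d"
  proof -
    have "continuous_on {0<..} (deriv s)"
      by (rule DERIV_continuous_on[of _ _ s2]) (simp add: has_field_derivative_at_within s2(1))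
    then have "continuous_on UNIV (\<lambda>x. deriv s (exp x))" "continuous_on UNIV (\<lambda>x. s2 (exp x))"
      using s2(2) by (auto elim!: continuous_on_compose2 intro!: continuous_on_exp continuous_on_id)
    then show ?thesis unfolding d_def by (intro continuous_intros)
  qed
  ultimately have "\<And>x. (h has_real_derivative deriv h x) (at x)"
    "\<And>x. (deriv h has_real_derivative deriv (deriv h) x) (at x)"
    "continuous_on UNIV (deriv (deriv h))"
    using p d by simp_all
  then show thesis by (rule that)
qed

section \<open>Phragmen-Lindelof on the strip and Liouville's theorem\<close>

theorem theorem1p4:
  fixes s h :: "real \<Rightarrow> real" and f :: "complex \<Rightarrow> complex"
  assumes "mono_on {0<..} s"
    and "s C2_differentiable_on {0<..}"
    and "\<And>x. h x = s (exp x)"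
    and "f holomorphic_on UNIV"
    and "finite_exponential_type f"
    and "bounded (f ` rotating_half_plane s)"
    and "(\<integral>\<^sup>+x\<in>{0..}. ennreal ((deriv h x)\<^sup>2) \<partial>lborel) = \<infinity>"
    and "(\<integral>\<^sup>+x\<in>{0..}. ennreal \<bar>deriv (deriv h) x\<bar> \<partial>lborel) < \<infinity>"
  shows "f constant_on UNIV"
proof -
  define p d where "p = deriv h" and "d = deriv p"
  obtain h': "\<And>x. (h has_real_derivative p x) (at x)" and p': "\<And>x. (p has_real_derivative d x) (at x)"
    and d: "continuous_on UNIV d"
    by (rule half_plane_C2_log[OF assms(2,3), folded p_def, folded d_def]) (rule that; assumption)
  have p: "continuous_on UNIV p"
    by (rule DERIV_continuous_on) (rule has_field_derivative_at_within[OF p'])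
  obtain I where I: "\<And>x. (I has_real_derivative \<bar>d x\<bar>) (at x)"
    by (rule antiderivative_exists[of "\<lambda>x. \<bar>d x\<bar>"]) (auto intro!: continuous_intros d)
  obtain G where G: "\<And>x. (G has_real_derivative (p x)\<^sup>2) (at x)"
    by (rule antiderivative_exists[of "\<lambda>x. (p x)\<^sup>2"]) (auto intro!: continuous_intros p)
  have "(\<exists>T. \<forall>x\<ge>0. I x \<le> T)"
    using half_line_integral_bounded_iff[OF I, of 0] assms(8) d
    by (auto simp: p_def d_def continuous_intros)
  then obtain T where T: "\<And>x. 0 \<le> x \<Longrightarrow> I x \<le> T" by auto
  have G_unbdd: "\<not> (\<exists>T. \<forall>x\<ge>0. G x \<le> T)"
    using half_line_integral_bounded_iff[OF G, of 0] assms(7) p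
    by (auto simp: p_def continuous_intros)
  have G_mono: "G x \<le> G y" if "x \<le> y" for x y
    by (rule DERIV_nonneg_imp_nondecreasing[OF that]) (auto intro!: exI G)
  have G_lim: "filterlim G at_top at_top"
    unfolding filterlim_at_top
  proof
    fix Z
    obtain x where "Z \<le> G x" using G_unbdd by (meson linear)
    then show "\<forall>\<^sub>F x in at_top. Z \<le> G x"
      using G_mono by (intro eventually_at_top_linorderI[of x]) (meson order_trans)
  qed
  define c where "c = (\<lambda>x. h x + 3 * pi / 2)"
  have c: "(c has_real_derivative p x) (at x)" for x
    unfolding c_def using h' by (auto intro!: derivative_eq_intros)
  have c_cont: "continuous_on S c" for S
    by (rule DERIV_continuous_on) (rule has_field_derivative_at_within[OF c])
  obtain a A C where a: "0 \<le> a" and A: "0 < A" and V: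
    "\<And>X. a \<le> X \<Longrightarrow> \<exists>V Vx Vxx Vy Vyy.
      continuous_on UNIV V \<and>
      (\<forall>x y. ((\<lambda>x. V (Complex x y)) has_real_derivative Vx (Complex x y)) (at x)) \<and>
      (\<forall>x y. ((\<lambda>x. Vx (Complex x y)) has_real_derivative Vxx (Complex x y)) (at x)) \<and>
      (\<forall>x y. ((\<lambda>y. V (Complex x y)) has_real_derivative Vy (Complex x y)) (at y)) \<and>
      (\<forall>x y. ((\<lambda>y. Vy (Complex x y)) has_real_derivative Vyy (Complex x y)) (at y)) \<and>
      (\<forall>x y. a \<le> x \<longrightarrow> x \<le> X \<longrightarrow> \<bar>y - c x\<bar> \<le> pi / 2 \<longrightarrow>
         Vxx (Complex x y) + Vyy (Complex x y) < 0 \<and> 0 \<le> V (Complex x y) \<and>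
         V (Complex x y) \<le> C * exp (x + G x)) \<and>
      (\<forall>y. \<bar>y - c X\<bar> \<le> pi / 2 \<longrightarrow> A * exp (X + G X) \<le> V (Complex X y))"
    by (rule growing_superharmonic_exists[OF c p' d I G]) (rule T, assumption, (rule that; assumption))
  have f_cont: "continuous_on S f" for S
    using assms(4) holomorphic_on_imp_continuous_on continuous_on_subset by blast
  obtain M1 where M1: "\<And>z. z \<in> rotating_half_plane s \<Longrightarrow> norm (f z) \<le> M1"
    using assms(6) by (auto simp: bounded_iff)
  obtain M2 where M2: "\<And>z. norm z \<le> exp a \<Longrightarrow> norm (f z) \<le> M2"
    using compact_imp_bounded[OF compact_continuous_image[OF f_cont compact_cball[of 0 "exp a"]]]
    unfolding bounded_iff by (metis image_eqI mem_cball_0)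
  obtain A0 B where B: "0 < A0" "0 < B" "\<And>z. norm (f z) \<le> A0 * exp (B * norm z)"
    using assms(5) by (auto simp: finite_exponential_type_def)
  \<comment> \<open>One constant for all sides of the truncated strip: \<open>A0\<close> serves on
    the right, \<open>M1\<close> on the two curved edges, and \<open>M2\<close> on the left, which
    \<open>exp\<close> maps to the circle of radius \<open>exp a\<close>.\<close>
  define M where "M = max A0 (max M1 M2)"
  have M: "0 < M" "A0 \<le> M" "M1 \<le> M" "M2 \<le> M" using B(1) by (auto simp: M_def)
  have strip: "norm (f (exp (Complex x y))) \<le> M" if "h x \<le> y" "y \<le> h x + pi" for x y
    using bounded_strip[where f = f and s = s and M = M1 and x = x and y = y, OF f_cont M1] that M(3) by (auto simp: assms(3))
  \<comment> \<open>The edges are \<open>y = h x + pi\<close> and \<open>y = h x + 2 * pi\<close>;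
    the second is the boundary \<open>y = h x\<close> of the half-plane moved by the period of
    \<open>exp\<close>.\<close>
  have edge: "norm (f (exp (Complex x y))) \<le> M" if "\<bar>y - c x\<bar> = pi / 2" for x y
  proof -
    have "y = h x + pi \<or> y = h x + 2 * pi * of_int 1" using that by (auto simp: c_def abs_if split: if_splits)
    then show ?thesis
      using strip[of x "h x"] strip[of x "h x + pi"] exp_Complex_shift[of x "h x" 1] by auto
  qed
  have finite_bound: "norm (f (exp (Complex x y))) \<le> M * exp (B / A * C * exp (x + G x) * exp (- G X))"
    if x: "a \<le> x" "x \<le> X" and y: "\<bar>y - c x\<bar> \<le> pi / 2" for x y X
  proof -
    have "a \<le> X" using x by simp
    from V[OF this] obtain V Vx Vxx Vy Vyy where
      Vc: "continuous_on UNIV V" and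
      Vx: "\<And>x y. ((\<lambda>x. V (Complex x y)) has_real_derivative Vx (Complex x y)) (at x)" and
      Vxx: "\<And>x y. ((\<lambda>x. Vx (Complex x y)) has_real_derivative Vxx (Complex x y)) (at x)" and
      Vy: "\<And>x y. ((\<lambda>y. V (Complex x y)) has_real_derivative Vy (Complex x y)) (at y)" and
      Vyy: "\<And>x y. ((\<lambda>y. Vy (Complex x y)) has_real_derivative Vyy (Complex x y)) (at y)" and
      VS: "\<And>x y. a \<le> x \<Longrightarrow> x \<le> X \<Longrightarrow> \<bar>y - c x\<bar> \<le> pi / 2 \<Longrightarrow>
         Vxx (Complex x y) + Vyy (Complex x y) < 0 \<and> 0 \<le> V (Complex x y) \<and>
         V (Complex x y) \<le> C * exp (x + G x)" and
      VX: "\<And>y. \<bar>y - c X\<bar> \<le> pi / 2 \<Longrightarrow> A * exp (X + G X) \<le> V (Complex X y)"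
      by blast
    \<comment> \<open>On the side \<open>Re w = X\<close> one has
      \<open>V \<ge> A * exp (X + G X)\<close>, so this \<open>\<epsilon>\<close> makes
      \<open>\<epsilon> * V\<close> at least \<open>B * exp X\<close>, the exponent in the
      exponential type bound. It tends to 0 as \<open>G X\<close> tends to infinity.\<close>
    define \<epsilon> where "\<epsilon> = B / A * exp (- G X)"
    have \<epsilon>: "0 < \<epsilon>" using A B by (simp add: \<epsilon>_def)
    define S where "S = {w. a \<le> Re w \<and> Re w \<le> X \<and> \<bar>Im w - c (Re w)\<bar> \<le> pi / 2}"
    have S_iff: "w \<in> S \<longleftrightarrow> a \<le> Re w \<and> Re w \<le> X \<and> - (pi / 2) \<le> Im w - c (Re w) \<and> Im w - c (Re w) \<le> pi / 2" for w
      unfolding S_def mem_Collect_eq abs_le_iff by (safe; linarith)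
    have "S = (\<lambda>z. Complex (fst z) (c (fst z) + snd z)) ` ({a..X} \<times> {- (pi / 2)..pi / 2})"
    proof (intro equalityI subsetI)
      fix w assume "w \<in> S"
      then show "w \<in> (\<lambda>z. Complex (fst z) (c (fst z) + snd z)) ` ({a..X} \<times> {- (pi / 2)..pi / 2})"
        by (intro image_eqI[of _ _ "(Re w, Im w - c (Re w))"]) (auto simp: S_iff)
    qed (auto simp: S_iff)
    moreover have "continuous_on ({a..X} \<times> {- (pi / 2)..pi / 2}) (\<lambda>z. Complex (fst z) (c (fst z) + snd z))"
      unfolding Complex_eq
      by (intro continuous_intros continuous_on_compose2[OF c_cont[of UNIV]]) auto
    ultimately have S: "compact S"
      by (simp add: compact_continuous_image compact_Times)
    have cRe: "continuous_on UNIV (\<lambda>w. c (Re w))"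
      by (intro continuous_on_compose2[OF c_cont[of UNIV]] continuous_intros) auto
    define U where "U = {w. a < Re w \<and> Re w < X \<and> \<bar>Im w - c (Re w)\<bar> < pi / 2}"
    have "open U"
      unfolding U_def by (intro open_Collect_conj open_Collect_less continuous_intros cRe)
    moreover have "U \<subseteq> S" by (auto simp: U_def S_def)
    ultimately have "U \<subseteq> interior S" by (simp add: interior_maximal)
    then have int: "w \<in> interior S" if "a < Re w" "Re w < X" "\<bar>Im w - c (Re w)\<bar> < pi / 2" for w
      using that by (auto simp: U_def)
    have "norm ((f \<circ> exp) (Complex x y)) \<le> M * exp (\<epsilon> * V (Complex x y))"
    proof (rule norm_le_exp_superharmonic[where S = S and F = "f \<circ> exp" and V = "\<lambda>w. \<epsilon> * V w"
          and Vx = "\<lambda>w. \<epsilon> * Vx w" and Vxx = "\<lambda>w. \<epsilon> * Vxx w"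
          and Vy = "\<lambda>w. \<epsilon> * Vy w" and Vyy = "\<lambda>w. \<epsilon> * Vyy w"])
      show "f \<circ> exp holomorphic_on UNIV"
        by (intro holomorphic_on_compose holomorphic_intros) (auto intro: holomorphic_on_subset[OF assms(4)])
      show "continuous_on S (\<lambda>w. \<epsilon> * V w)"
        using Vc by (intro continuous_intros) (auto intro: continuous_on_subset)
      show "\<epsilon> * Vxx w + \<epsilon> * Vyy w < 0" if "w \<in> interior S" for w
      proof -
        have "w \<in> S" using that interior_subset by blast
        then have "Vxx w + Vyy w < 0" using VS[of "Re w" "Im w"] by (simp add: S_def)
        then have "\<epsilon> * (Vxx w + Vyy w) < 0" by (rule mult_pos_neg[OF \<epsilon>])
        then show ?thesis by (simp add: distrib_left)
      qed
      show "norm ((f \<circ> exp) w) \<le> M * exp (\<epsilon> * V w)" if w: "w \<in> S" "w \<notin> interior S" for w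
      proof -
        have V0: "0 \<le> V w" using VS[of "Re w" "Im w"] w(1) by (simp add: S_def)
        have *: ?thesis if "norm (f (exp w)) \<le> M"
        proof -
          have "M * 1 \<le> M * exp (\<epsilon> * V w)" using M \<epsilon> V0 by (intro mult_left_mono) auto
          with that show ?thesis by simp
        qed
        consider "Re w = a" | "Re w = X" | "\<bar>Im w - c (Re w)\<bar> = pi / 2"
          using int[of w] w unfolding S_def mem_Collect_eq by linarith
        then show ?thesis
        proof cases
          case 1
          then show ?thesis using M2[of "exp w"] M by (intro *) auto
        next
          case 2
          have "\<epsilon> * (A * exp (X + G X)) \<le> \<epsilon> * V w"
            using VX[of "Im w"] w(1) 2 \<epsilon> by (intro mult_left_mono) (auto simp: S_def)
          also have "\<epsilon> * (A * exp (X + G X)) = B * norm (exp w)"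
            using A by (simp add: \<epsilon>_def 2 exp_add exp_minus)
          finally have "A0 * exp (B * norm (exp w)) \<le> M * exp (\<epsilon> * V w)"
            using M by (intro mult_mono) auto
          then show ?thesis using B(3)[of "exp w"] by simp
        next
          case 3
          then show ?thesis using edge[of "Im w" "Re w"] by (intro *) auto
        qed
      qed
      show "Complex x y \<in> S" using x y by (simp add: S_def)
    qed (use M S in \<open>auto intro!: DERIV_cmult Vx Vxx Vy Vyy\<close>)
    also have "\<epsilon> * V (Complex x y) \<le> \<epsilon> * (C * exp (x + G x))"
      using VS[OF x y] \<epsilon> by (intro mult_left_mono) auto
    also have "\<dots> = B / A * C * exp (x + G x) * exp (- G X)" by (simp add: \<epsilon>_def)
    finally show ?thesis using M by simp
  qed
  have strip2: "norm (f (exp (Complex x y))) \<le> M" if x: "a \<le> x" and y: "\<bar>y - c x\<bar> \<le> pi / 2" for x y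
  proof -
    \<comment> \<open>In \<open>finite_bound\<close> only the right-hand side contains
      \<open>X\<close>, so \<open>X\<close> may tend to infinity with the point kept fixed. This is
      where the divergence of the integral of \<open>h'\<close> squared enters.\<close>
    have "((\<lambda>X. exp (- G X)) \<longlongrightarrow> 0) at_top"
      by (rule filterlim_compose[OF exp_at_bot]) (use G_lim in \<open>simp add: filterlim_uminus_at_bot\<close>)
    then have lim: "((\<lambda>X. M * exp (B / A * C * exp (x + G x) * exp (- G X))) \<longlongrightarrow>
        M * exp (B / A * C * exp (x + G x) * 0)) at_top"
      by (intro tendsto_intros)
    have "\<forall>\<^sub>F X in at_top. norm (f (exp (Complex x y))) \<le> M * exp (B / A * C * exp (x + G x) * exp (- G X))"
      using finite_bound[OF x _ y] by (intro eventually_at_top_linorderI[of x])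
    from tendsto_lowerbound[OF lim this] show ?thesis by simp
  qed
  have "norm (f z) \<le> M" for z
  proof (cases "norm z \<le> exp a")
    case False
    then have z: "exp a < norm z" "z \<noteq> 0" by (auto simp: not_le)
    define x where "x = ln (norm z)"
    have x: "a \<le> x" unfolding x_def using z by (subst ln_ge_iff) auto
    \<comment> \<open>This selects the branch of the argument in the interval of length
      \<open>2 * pi\<close> that starts at \<open>h x\<close>; the closed half-plane and the strip
      together cover that interval.\<close>
    define n where "n = \<lfloor>(Arg z - h x) / (2 * pi)\<rfloor>"
    define y where "y = Arg z + 2 * pi * of_int (- n)"
    have "z = exp (Complex x (Arg z))"
      using z by (simp add: exp_eq_polar x_def) (metis Arg_eq rcis_cmod_Arg rcis_def)
    also have "\<dots> = exp (Complex x y)" unfolding y_def by (rule exp_Complex_shift[symmetric])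
    finally have zy: "z = exp (Complex x y)" .
    have "of_int n \<le> (Arg z - h x) / (2 * pi)" "(Arg z - h x) / (2 * pi) < of_int n + 1"
      unfolding n_def by linarith+
    then have "h x \<le> y" "y \<le> h x + 2 * pi" by (auto simp: y_def field_simps)
    then consider "h x \<le> y" "y \<le> h x + pi" | "\<bar>y - c x\<bar> \<le> pi / 2"
      unfolding c_def abs_le_iff by linarith
    then show ?thesis
      unfolding zy by cases (use strip strip2[OF x] in blast)+
  qed (use M2 M in force)
  then have "bounded (range f)" by (auto simp: bounded_iff)
  with assms(4) show ?thesis by (rule Liouville_theorem)
qed

end
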